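(* Consider the single-resource loss network with advance reservations and capacity $C$ described in the context, where the resource requirements $\{B_n\}$ are i.i.d. subexponential, the holding times $\{\theta_n\}$ are i.i.d. with finite mean, and the reservation delays $\{D_n\}$ are i.i.d. with finite mean. Then the blocking probability in this system is asymptotically equivalent to $\Pr[B>C]$ as $C\to\infty$, i.e. $$\Pr[\text{request } n \text{ is lost}]\sim \Pr[B>C]\qquad\text{as } C\to\infty .$$
   Context: Model. Requests for resources from a common pool of capacity $C<\infty$ arrive at time points $\{\tau_n,-\infty<n<\infty\}$ forming a renewal process with rate $0<\lambda<\infty$, i.e. the interarrival times are i.i.d. with $\mathbb{E}[\tau_n-\tau_{n-1}]=1/\lambda$. The request arriving at $\tau_n$ asks for an amount $B_n$ of the resource during the time interval $(\tau_n+D_n,\tau_n+D_n+\theta_n)$, where $D_n\ge 0$ is a reservation delay and $\theta_n$ is a holding time. The request is lost (blocked) if at any moment of time in $(\tau_n+D_n,\tau_n+D_n+\theta_n)$ the total amount of active requirements of previously accepted requests (those that arrived prior to $\tau_n$ and were accepted, request $i$ being active during $(\tau_i+D_i,\tau_i+D_i+\theta_i)$) exceeds $C-B_n$; otherwise it is accepted. In particular, a request with $B_n>C$ is lost. The sequences $\{B_n\}$, $\{\theta_n\}$, $\{D_n\}$ each consist of i.i.d. random variables, they are independent of each other and of $\{\tau_n\}$, and $\mathbb{E}\theta_n<\infty$, $\mathbb{E}D_n<\infty$. The random variable $B$ has the common distribution of the $B_n$. The blocking probability is the probability that a request is lost in the stationary regime of the system. Subexponentiality. A distribution function $F$ of a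 positive random variable with $F(x)<1$ for all $x>0$ is subexponential ($F\in\mathcal{S}$) if, with $X_1,X_2,\dots$ i.i.d. with distribution $F$ and $\bar F(x)=1-F(x)$, one has $\lim_{x\to\infty}\Pr[X_1+\dots+X_n>x]/\bar F(x)=n$ for some (equivalently all) $n\ge 2$. A random variable is subexponential if its distribution function is. The distribution of $B$ is assumed subexponential. Notation: $a(t)\sim b(t)$ as $t\to t_0$ means $\lim_{t\to t_0}a(t)/b(t)=1$. *)

theory Defs
  imports "HOL-Probability.Probability" "HOL-Library.Landau_Symbols"
begin

definition subexponential :: "real measure \<Rightarrow> bool" where
  "subexponential \<mu> \<longleftrightarrow>
     real_distribution \<mu> \<and> (AE x in \<mu>. 0 < x) \<and> (\<forall>x>0. cdf \<mu> x < 1) \<and>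
     (\<exists>n\<ge>2. ((\<lambda>x. measure (Pi\<^sub>M {..<n} (\<lambda>_. \<mu>))
                      {w \<in> space (Pi\<^sub>M {..<n} (\<lambda>_. \<mu>)). (\<Sum>i<n. w i) > x} / (1 - cdf \<mu> x))
                \<longlongrightarrow> real n) at_top)"

definition interarrival :: "(int \<Rightarrow> 'a \<Rightarrow> real) \<Rightarrow> int \<Rightarrow> 'a \<Rightarrow> real" where
  "interarrival \<tau> n \<omega> = \<tau> n \<omega> - \<tau> (n - 1) \<omega>"

definition (in prob_space) iid :: "(int \<Rightarrow> 'a \<Rightarrow> real) \<Rightarrow> bool" where
  "iid X \<longleftrightarrow> indep_vars (\<lambda>_. borel) X UNIV \<and>
            (\<forall>n. distr M borel (X n) = distr M borel (X 0))"

(* The arrival epochs, requirements, holding times and reservation delays are doubly infinite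
   sequences. Holding times are almost surely positive, so that the requested interval is nonempty
   and a request with requirement above the capacity is indeed lost. Interarrival times may
   vanish; simultaneous requests are then served in the order of their indices. *)
locale reservation_system = prob_space M
  for M :: "'a measure" +
  fixes rate :: real and \<tau> B \<theta> D :: "int \<Rightarrow> 'a \<Rightarrow> real"
  assumes rate_pos: "0 < rate"
    and iid_interarrival: "iid (interarrival \<tau>)"
    and iid_B: "iid B"
    and iid_holding: "iid \<theta>"
    and iid_delay: "iid D"
    and indep_sequences:
      "indep_vars (\<lambda>_. Pi\<^sub>M UNIV (\<lambda>_. borel)) (\<lambda>k \<omega> n. ([\<tau>, B, \<theta>, D] ! k) n \<omega>) {..<4}"
    and interarrival_nonneg: "\<And>n. AE \<omega> in M. 0 \<le> interarrival \<tau> n \<omega>"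
    and holding_pos: "\<And>n. AE \<omega> in M. 0 < \<theta> n \<omega>"
    and delay_nonneg: "\<And>n. AE \<omega> in M. 0 \<le> D n \<omega>"
    and interarrival_integrable: "\<And>n. integrable M (interarrival \<tau> n)"
    and interarrival_mean: "\<And>n. expectation (interarrival \<tau> n) = 1 / rate"
    and holding_integrable: "\<And>n. integrable M (\<theta> n)"
    and delay_integrable: "\<And>n. integrable M (D n)"

definition active_period ::
    "(int \<Rightarrow> 'a \<Rightarrow> real) \<Rightarrow> (int \<Rightarrow> 'a \<Rightarrow> real) \<Rightarrow> (int \<Rightarrow> 'a \<Rightarrow> real) \<Rightarrow> int \<Rightarrow> 'a \<Rightarrow> real set" where
  "active_period \<tau> \<theta> D n \<omega> = {\<tau> n \<omega> + D n \<omega> <..< \<tau> n \<omega> + D n \<omega> + \<theta> n \<omega>}"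

(* In a reservation system, for t in the active period of request n (so that t is after the
   arrival of n), the index set of this sum is almost surely finite, whatever lost is, because
   holding times and delays have finite mean. *)
definition prior_load ::
    "(int \<Rightarrow> 'a \<Rightarrow> real) \<Rightarrow> (int \<Rightarrow> 'a \<Rightarrow> real) \<Rightarrow> (int \<Rightarrow> 'a \<Rightarrow> real) \<Rightarrow> (int \<Rightarrow> 'a \<Rightarrow> real) \<Rightarrow>
     (int \<Rightarrow> 'a \<Rightarrow> bool) \<Rightarrow> int \<Rightarrow> real \<Rightarrow> 'a \<Rightarrow> real" where
  "prior_load \<tau> B \<theta> D lost n t \<omega> =
     (\<Sum>i | i < n \<and> \<not> lost i \<omega> \<and> t \<in> active_period \<tau> \<theta> D i \<omega>. B i \<omega>)"

definition loss_rule ::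
    "(int \<Rightarrow> 'a \<Rightarrow> real) \<Rightarrow> (int \<Rightarrow> 'a \<Rightarrow> real) \<Rightarrow> (int \<Rightarrow> 'a \<Rightarrow> real) \<Rightarrow> (int \<Rightarrow> 'a \<Rightarrow> real) \<Rightarrow>
     real \<Rightarrow> (int \<Rightarrow> 'a \<Rightarrow> bool) \<Rightarrow> 'a \<Rightarrow> bool" where
  "loss_rule \<tau> B \<theta> D C lost \<omega> \<longleftrightarrow>
     (\<forall>n. lost n \<omega> \<longleftrightarrow>
        (\<exists>t \<in> active_period \<tau> \<theta> D n \<omega>. prior_load \<tau> B \<theta> D lost n t \<omega> > C - B n \<omega>))"

(* The loss indicators solve the loss recursion on all of the integers, with no initial condition,
   and the law of the input sequences together with the loss indicators is invariant under shifts
   of the request index. *)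
definition stationary_regime ::
    "'a measure \<Rightarrow> (int \<Rightarrow> 'a \<Rightarrow> real) \<Rightarrow> (int \<Rightarrow> 'a \<Rightarrow> real) \<Rightarrow> (int \<Rightarrow> 'a \<Rightarrow> real) \<Rightarrow>
     (int \<Rightarrow> 'a \<Rightarrow> real) \<Rightarrow> real \<Rightarrow> (int \<Rightarrow> 'a \<Rightarrow> bool) \<Rightarrow> bool" where
  "stationary_regime M \<tau> B \<theta> D C lost \<longleftrightarrow>
     (\<forall>n. lost n \<in> measurable M (count_space UNIV)) \<and>
     (AE \<omega> in M. loss_rule \<tau> B \<theta> D C lost \<omega>) \<and>
     (let S = Pi\<^sub>M UNIV (\<lambda>_::int. borel \<Otimes>\<^sub>M borel \<Otimes>\<^sub>M borel \<Otimes>\<^sub>M borel \<Otimes>\<^sub>M count_space UNIV);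
          Z = (\<lambda>k \<omega> n. (interarrival \<tau> (n + k) \<omega>, B (n + k) \<omega>, \<theta> (n + k) \<omega>, D (n + k) \<omega>,
                        lost (n + k) \<omega>))
      in \<forall>k. distr M S (Z k) = distr M S (Z 0))"

end

theory Submission
  imports Defs "HOL-Real_Asymp.Real_Asymp"
begin

text \<open>A request whose requirement exceeds \<open>C\<close> is always lost, so the blocking probability is at least
\<open>P(B > C)\<close>. What has to be shown is that losses caused by other requests are negligible compared
with \<open>P(B > C)\<close>. The mechanism is the principle of one big jump: a sum of finitely many
subexponential terms exceeds \<open>C\<close> essentially only because one single term does, and a request
above \<open>C\<close> is itself lost and therefore blocks nobody.

If request \<open>n\<close> is lost although \<open>B n \<le> C\<close>, then at some instant of its active period the accepted
requests overload the system together with it. Each of them was accepted, hence has requirement at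
most \<open>C\<close>, arrived before request \<open>n\<close> and is not yet finished at time \<open>\<tau> n\<close>. So the sum of the
requirements, with those above \<open>C\<close> replaced by \<open>0\<close>, over request \<open>n\<close> and all requests \<open>pending\<close> at
time \<open>\<tau> n\<close> exceeds \<open>C\<close> (\<open>overload_if_lost\<close>). The set of pending requests depends only on arrival
times, delays and holding times, so it is independent of the requirements.

Two facts then finish the proof. For a fixed number \<open>k\<close> of terms the probability that the truncated
sum exceeds \<open>C\<close> is \<open>o(P(B > C))\<close> (\<open>prob_truncated_sum_gt\<close>, \<open>excess_negligible\<close>), and for every
\<open>c > 1\<close> it is at most \<open>K c\<^sup>k P(B > C)\<close>, uniformly in \<open>k\<close> and \<open>C\<close>, by Kesten's inequality
(\<open>tail_le_geometric\<close>, \<open>excess_le_geometric\<close>). The number of pending requests has a finite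
exponential moment, whatever the tails of delays and holding times (\<open>exp_moment_count_uncovered\<close>):
the request of lag \<open>k\<close> is pending only if its delay or its holding time exceeds a multiple
of \<open>k\<close>, which are events independent between lags and of summable probabilities because the means
are finite, or if the arrival process was unusually fast over the last
\<open>k\<close> arrivals, which has exponentially small probability. Dominated convergence over the number of
pending requests gives the claim.\<close>

section \<open>Tails of convolution powers\<close>

primrec conv_power :: "real measure \<Rightarrow> nat \<Rightarrow> real measure" where
  "conv_power \<mu> 0 = return borel 0"
| "conv_power \<mu> (Suc k) = convolution \<mu> (conv_power \<mu> k)"

definition ccdf :: "real measure \<Rightarrow> real \<Rightarrow> real" where
  "ccdf \<mu> x = measure \<mu> {x<..}"

definition conv_tail :: "real measure \<Rightarrow> nat \<Rightarrow> real \<Rightarrow> real" where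
  "conv_tail \<mu> k x = ccdf (conv_power \<mu> k) x"

lemma (in prob_space) distr_sum_iid:
  fixes X :: "'i \<Rightarrow> 'a \<Rightarrow> real"
  assumes "finite A" "indep_vars (\<lambda>_. borel) X A" "\<And>i. i \<in> A \<Longrightarrow> distr M borel (X i) = \<mu>"
  shows "distr M borel (\<lambda>\<omega>. \<Sum>i\<in>A. X i \<omega>) = conv_power \<mu> (card A)"
  using assms
proof (induction A rule: finite_induct)
  case empty
  have "distr M borel (\<lambda>_. 0::real) = return borel 0"
    by (rule measure_eqI) (auto simp: emeasure_distr emeasure_space_1 split: split_indicator)
  then show ?case by simp
next
  case (insert i A)
  have rv: "j \<in> insert i A \<Longrightarrow> random_variable borel (X j)" for j
    using insert.prems(1) by (auto simp: indep_vars_def)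
  have "indep_vars (\<lambda>_. borel) X A"
    using insert.prems(1) by (rule indep_vars_subset) auto
  then have IH: "distr M borel (\<lambda>\<omega>. \<Sum>i\<in>A. X i \<omega>) = conv_power \<mu> (card A)"
    using insert by auto
  have "distr M borel (\<lambda>\<omega>. X i \<omega> + (\<Sum>i\<in>A. X i \<omega>))
      = convolution (distr M borel (X i)) (distr M borel (\<lambda>\<omega>. \<Sum>i\<in>A. X i \<omega>))"
    using insert rv by (intro sum_indep_random_variable indep_vars_sum) auto
  then show ?case
    using insert IH by simp
qed

corollary (in prob_space) prob_sum_iid_gt:
  fixes X :: "'i \<Rightarrow> 'a \<Rightarrow> real"
  assumes "finite A" "indep_vars (\<lambda>_. borel) X A" "\<And>i. i \<in> A \<Longrightarrow> distr M borel (X i) = \<mu>"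
  shows "prob {\<omega> \<in> space M. x < (\<Sum>i\<in>A. X i \<omega>)} = conv_tail \<mu> (card A) x"
proof -
  have "(\<lambda>\<omega>. \<Sum>i\<in>A. X i \<omega>) \<in> borel_measurable M"
    using assms(2) by (intro borel_measurable_sum) (auto simp: indep_vars_def)
  then have "prob {\<omega> \<in> space M. x < (\<Sum>i\<in>A. X i \<omega>)} = measure (distr M borel (\<lambda>\<omega>. \<Sum>i\<in>A. X i \<omega>)) {x<..}"
    by (subst measure_distr) (auto intro!: arg_cong[where f=prob])
  then show ?thesis
    using distr_sum_iid[OF assms] by (simp add: conv_tail_def ccdf_def)
qed

lemma ccdf_eq_cdf: "real_distribution \<mu> \<Longrightarrow> ccdf \<mu> x = 1 - cdf \<mu> x"
proof -
  assume "real_distribution \<mu>"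
  then interpret real_distribution \<mu> .
  have "{x<..} = space \<mu> - {..x}"
    by auto
  then show ?thesis
    unfolding ccdf_def by (metis prob_compl events_eq_borel borel_closed closed_atMost cdf_def)
qed

locale positive_law = real_distribution \<mu> for \<mu> +
  assumes AE_pos: "AE x in \<mu>. 0 < x"
begin

abbreviation tail where "tail \<equiv> conv_tail \<mu>"
abbreviation surv where "surv \<equiv> ccdf \<mu>"

lemma prob_UNIV [simp]: "prob UNIV = 1"
  using prob_space by simp

lemma prob_space_conv_power: "prob_space (conv_power \<mu> k)"
  and sets_conv_power [simp, measurable_cong]: "sets (conv_power \<mu> k) = sets borel"
proof -
  show "prob_space (conv_power \<mu> k)"
  proof (induction k)
    case (Suc k)
    have [measurable_cong]: "sets (conv_power \<mu> k) = sets borel"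
      by (cases k) auto
    show ?case
      by (auto simp: convolution_def intro!: prob_space.prob_space_distr[OF prob_space_pair] Suc prob_space_axioms)
  qed (simp add: prob_space_return)
  show "sets (conv_power \<mu> k) = sets borel"
    by (cases k) auto
qed

lemma real_distribution_conv_power: "real_distribution (conv_power \<mu> k)"
  by (simp add: real_distribution_def real_distribution_axioms_def prob_space_conv_power)

lemma tail_eq_cdf: "tail k x = 1 - cdf (conv_power \<mu> k) x"
  by (simp add: conv_tail_def ccdf_eq_cdf real_distribution_conv_power)

lemma tail_nonneg [simp]: "0 \<le> tail k x"
  by (simp add: conv_tail_def ccdf_def)

lemma tail_le_1 [simp]: "tail k x \<le> 1"
  unfolding conv_tail_def ccdf_def by (rule prob_space.prob_le_1[OF prob_space_conv_power])

lemma tail_antimono: "x \<le> y \<Longrightarrow> tail k y \<le> tail k x"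
  by (simp add: tail_eq_cdf finite_borel_measure.cdf_nondecreasing
      real_distribution.finite_borel_measure_M real_distribution_conv_power)

lemma tail_at_top: "(tail k \<longlongrightarrow> 0) at_top"
proof -
  interpret P: real_distribution "conv_power \<mu> k" by (rule real_distribution_conv_power)
  have "((\<lambda>x. 1 - cdf (conv_power \<mu> k) x) \<longlongrightarrow> 1 - 1) at_top"
    by (intro tendsto_intros P.cdf_lim_at_top_prob)
  then show ?thesis
    by (simp add: tail_eq_cdf[abs_def])
qed

lemma borel_measurable_tail [measurable]: "tail k \<in> borel_measurable borel"
proof -
  have "mono (\<lambda>x. - tail k x)"
    by (auto simp: mono_def tail_antimono)
  then have "(\<lambda>x. - (- tail k x)) \<in> borel_measurable borel"
    by (intro borel_measurable_uminus borel_measurable_mono)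
  then show ?thesis by simp
qed

lemma integrable_tail_shift [simp]: "integrable \<mu> (\<lambda>y. tail k (x - y))"
  by (rule integrable_const_bound[where B=1]) auto

text \<open>Conditioning on one summand. Every estimate of tails below integrates a pointwise
inequality between functions of \<open>x - y\<close> against \<open>\<mu>\<close>.\<close>

lemma tail_Suc: "tail (Suc k) x = (\<integral>y. tail k (x - y) \<partial>\<mu>)"
proof -
  interpret P: real_distribution "conv_power \<mu> k" by (rule real_distribution_conv_power)
  have "ennreal (tail (Suc k) x) = emeasure (conv_power \<mu> (Suc k)) {x<..}"
    unfolding conv_tail_def ccdf_def
    by (intro finite_measure.emeasure_eq_measure[symmetric] prob_space.finite_measure prob_space_conv_power)
  also have "\<dots> = (\<integral>\<^sup>+y. emeasure (conv_power \<mu> k) {a. a + y \<in> {x<..}} \<partial>\<mu>)"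
    by (simp only: conv_power.simps, rule convolution_emeasure) (auto intro: P.finite_measure)
  also have "\<dots> = (\<integral>\<^sup>+y. ennreal (tail k (x - y)) \<partial>\<mu>)"
  proof (intro nn_integral_cong)
    fix y
    have "{a. a + y \<in> {x<..}} = {x - y<..}" by auto
    then show "emeasure (conv_power \<mu> k) {a. a + y \<in> {x<..}} = ennreal (tail k (x - y))"
      by (simp add: conv_tail_def ccdf_def P.emeasure_eq_measure)
  qed
  also have "\<dots> = ennreal (\<integral>y. tail k (x - y) \<partial>\<mu>)"
    by (rule nn_integral_eq_integral) auto
  finally show ?thesis
    by (simp add: integral_nonneg_AE)
qed

lemma tail_0: "tail 0 x = (if x < 0 then 1 else 0)"
  by (simp add: conv_tail_def ccdf_def measure_return indicator_def)

lemma tail_1: "tail (Suc 0) x = surv x"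
proof -
  have "tail 1 x = (\<integral>y. indicator {x<..} y \<partial>\<mu>)"
    unfolding One_nat_def tail_Suc by (intro Bochner_Integration.integral_cong) (auto simp: tail_0 indicator_def)
  then show ?thesis by (simp add: ccdf_def)
qed

lemma surv_nonneg [simp]: "0 \<le> surv x"
  and surv_le_1 [simp]: "surv x \<le> 1"
  and surv_antimono: "x \<le> y \<Longrightarrow> surv y \<le> surv x"
  and surv_at_top: "(surv \<longlongrightarrow> 0) at_top"
  and borel_measurable_surv [measurable]: "surv \<in> borel_measurable borel"
  and integrable_surv_shift [simp]: "integrable \<mu> (\<lambda>y. surv (x - y))"
  using tail_antimono[of x y 1] tail_at_top[of 1] borel_measurable_tail[of 1] integrable_tail_shift[of 1 x]
    tail_nonneg[of 1 x] tail_le_1[of 1 x]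
  by (simp_all add: tail_1[abs_def])

lemma tail_neg: "x < 0 \<Longrightarrow> tail k x = 1"
proof (induction k arbitrary: x)
  case (Suc k)
  have "(\<integral>y. tail k (x - y) \<partial>\<mu>) = (\<integral>y. 1 \<partial>\<mu>)"
    using AE_pos Suc by (intro integral_cong_AE) auto
  then show ?case by (simp add: tail_Suc)
qed (simp add: tail_0)

lemma surv_neg: "x < 0 \<Longrightarrow> surv x = 1"
  using tail_neg[of x 1] by (simp add: tail_1)

lemma integral_tail_le:
  assumes "\<And>z. tail k z \<le> f z"  "integrable \<mu> (\<lambda>y. f (x - y))"
  shows "tail (Suc k) x \<le> (\<integral>y. f (x - y) \<partial>\<mu>)"
  unfolding tail_Suc using assms by (intro integral_mono) auto

text \<open>Since the summands are positive, a sum of \<open>k + 1\<close> terms exceeds \<open>x\<close> as soon as the sum of the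
first \<open>k\<close> terms does or the last term does.\<close>

lemma tail_Suc_ge: "tail k x + (1 - tail k x) * surv x \<le> tail (Suc k) x"
proof -
  have "tail k x + (1 - tail k x) * surv x
      = (\<integral>y. tail k x + (1 - tail k x) * indicator {x<..} y \<partial>\<mu>)"
    by (simp add: ccdf_def integrable_real_indicator less_top[symmetric])
  also have "\<dots> \<le> (\<integral>y. tail k (x - y) \<partial>\<mu>)"
  proof (intro integral_mono_AE)
    show "AE y in \<mu>. tail k x + (1 - tail k x) * indicator {x<..} y \<le> tail k (x - y)"
      using AE_pos by eventually_elim (auto simp: indicator_def tail_neg intro: tail_antimono)
  qed (auto simp: integrable_real_indicator less_top[symmetric])
  finally show ?thesis by (simp add: tail_Suc)
qed

end

section \<open>Subexponential laws\<close>

text \<open>Subexponentiality in terms of convolution powers, to which \<open>subexponential_imp_law\<close>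
translates the product measures of the original definition.\<close>

locale subexponential_law = positive_law +
  assumes cdf_less_1: "\<And>x. 0 < x \<Longrightarrow> cdf \<mu> x < 1"
    and tail_ratio: "\<exists>n\<ge>2. ((\<lambda>x. tail n x / surv x) \<longlongrightarrow> real n) at_top"

lemma subexponential_imp_law:
  assumes "subexponential \<mu>"
  shows "subexponential_law \<mu>"
proof -
  interpret positive_law \<mu>
    using assms by (simp add: subexponential_def positive_law_def positive_law_axioms_def)
  obtain n where n: "n \<ge> 2"
    "((\<lambda>x. measure (Pi\<^sub>M {..<n} (\<lambda>_. \<mu>))
          {w \<in> space (Pi\<^sub>M {..<n} (\<lambda>_. \<mu>)). (\<Sum>i<n. w i) > x} / (1 - cdf \<mu> x)) \<longlongrightarrow> real n) at_top"
    using assms by (auto simp: subexponential_def)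
  interpret F: prob_space "Pi\<^sub>M {..<n} (\<lambda>_. \<mu>)"
    by (intro prob_space_PiM prob_space_axioms)
  have comp: "distr (Pi\<^sub>M {..<n} (\<lambda>_. \<mu>)) borel (\<lambda>w. w i) = \<mu>" if "i < n" for i
  proof -
    have "distr (Pi\<^sub>M {..<n} (\<lambda>_. \<mu>)) borel (\<lambda>w. w i) = distr (Pi\<^sub>M {..<n} (\<lambda>_. \<mu>)) \<mu> (\<lambda>w. w i)"
      by (rule distr_cong) auto
    then show ?thesis
      using distr_PiM_component[of "{..<n}" "\<lambda>_. \<mu>" i] that prob_space_axioms by simp
  qed
  have "F.indep_vars (\<lambda>_. borel) (\<lambda>i w. w i) {..<n}"
  proof (subst F.indep_vars_iff_distr_eq_PiM')
    have "distr (Pi\<^sub>M {..<n} (\<lambda>_. \<mu>)) (Pi\<^sub>M {..<n} (\<lambda>_. borel)) (\<lambda>x. \<lambda>i\<in>{..<n}. x i)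
        = distr (Pi\<^sub>M {..<n} (\<lambda>_. \<mu>)) (Pi\<^sub>M {..<n} (\<lambda>_. \<mu>)) (\<lambda>x. x)"
      by (rule distr_cong) (auto intro!: sets_PiM_cong simp: space_PiM)
    also have "\<dots> = Pi\<^sub>M {..<n} (\<lambda>i. distr (Pi\<^sub>M {..<n} (\<lambda>_. \<mu>)) borel (\<lambda>w. w i))"
      using comp by (auto intro!: PiM_cong simp: distr_id)
    finally show "distr (Pi\<^sub>M {..<n} (\<lambda>_. \<mu>)) (Pi\<^sub>M {..<n} (\<lambda>_. borel)) (\<lambda>x. \<lambda>i\<in>{..<n}. x i)
        = Pi\<^sub>M {..<n} (\<lambda>i. distr (Pi\<^sub>M {..<n} (\<lambda>_. \<mu>)) borel (\<lambda>w. w i))" .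
  qed (use n(1) in \<open>auto simp: lessThan_empty_iff\<close>)
  from F.prob_sum_iid_gt[OF _ this, of \<mu>] comp
  have "measure (Pi\<^sub>M {..<n} (\<lambda>_. \<mu>)) {w \<in> space (Pi\<^sub>M {..<n} (\<lambda>_. \<mu>)). (\<Sum>i<n. w i) > x} = tail n x" for x
    by simp
  then have "((\<lambda>x. tail n x / surv x) \<longlongrightarrow> real n) at_top"
    using n(2) by (simp add: ccdf_eq_cdf[OF real_distribution_axioms])
  then show ?thesis
    using n(1) assms by unfold_locales (auto simp: subexponential_def)
qed

context subexponential_law
begin

lemma surv_pos: "0 < surv x"
proof -
  have "0 < surv (max x 1)"
    using cdf_less_1[of "max x 1"] by (simp add: ccdf_eq_cdf[OF real_distribution_axioms])
  also have "\<dots> \<le> surv x"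
    by (rule surv_antimono) simp
  finally show ?thesis .
qed

text \<open>The upper bound passes from \<open>k + 1\<close> summands to \<open>k\<close> because one more summand always contributes
at least its own tail, by \<open>tail_Suc_ge\<close>. It leads from the order \<open>n\<close> for which subexponentiality is
assumed down to order \<open>2\<close>, on which the estimates below rest.\<close>

lemma tail_le_if_Suc:
  assumes "\<And>e. 0 < e \<Longrightarrow> \<forall>\<^sub>F x in at_top. tail (Suc k) x \<le> (real (Suc k) + e) * surv x"
    and "0 < e"
  shows "\<forall>\<^sub>F x in at_top. tail k x \<le> (real k + e) * surv x"
proof -
  have "\<forall>\<^sub>F x in at_top. tail k x < e / 2"
    using order_tendstoD(2)[OF tail_at_top, of "e / 2" k] assms(2) by simp
  moreover have "\<forall>\<^sub>F x in at_top. tail (Suc k) x \<le> (real (Suc k) + e / 2) * surv x"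
    using assms by simp
  ultimately show ?thesis
  proof eventually_elim
    case (elim x)
    have "tail k x * surv x \<le> e / 2 * surv x"
      using elim by (intro mult_right_mono) auto
    then show ?case
      using elim tail_Suc_ge[of k x] by (simp add: algebra_simps)
  qed
qed

lemma tail_2_le:
  assumes "0 < e"
  shows "\<forall>\<^sub>F x in at_top. tail 2 x \<le> (2 + e) * surv x"
proof -
  obtain n where n: "n \<ge> 2" "((\<lambda>x. tail n x / surv x) \<longlongrightarrow> real n) at_top"
    using tail_ratio by auto
  \<comment> \<open>Descend from the order n of the assumption to 2.\<close>
  have "\<forall>e>0. \<forall>\<^sub>F x in at_top. tail n x \<le> (real n + e) * surv x"
  proof safe
    fix e :: real assume "0 < e"
    then have "\<forall>\<^sub>F x in at_top. tail n x / surv x < real n + e"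
      using order_tendstoD(2)[OF n(2)] by simp
    then show "\<forall>\<^sub>F x in at_top. tail n x \<le> (real n + e) * surv x"
      by eventually_elim (use surv_pos in \<open>auto simp: field_simps\<close>)
  qed
  with n(1) have "\<forall>e>0. \<forall>\<^sub>F x in at_top. tail 2 x \<le> (real 2 + e) * surv x"
  proof (induction rule: inc_induct)
    case (step m)
    then show ?case using tail_le_if_Suc[of m] by blast
  qed
  then show ?thesis using assms by simp
qed

lemma integrable_indicator_shift [simp]:
  "A \<in> sets borel \<Longrightarrow> integrable \<mu> (\<lambda>y. indicator A (x - y) :: real)"
  by (rule integrable_const_bound[where B=1]) (auto simp: indicator_def)

lemma integral_indicator_shift:
  "A \<in> sets borel \<Longrightarrow> (\<integral>y. indicator A (x - y) \<partial>\<mu>) = measure \<mu> ((\<lambda>y. x - y) -` A)"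
proof -
  assume [measurable]: "A \<in> sets borel"
  have "(\<integral>y. indicator A (x - y) \<partial>\<mu>) = (\<integral>y. indicator ((\<lambda>y. x - y) -` A) y \<partial>\<mu> :: real)"
    by (intro Bochner_Integration.integral_cong) (auto simp: indicator_def)
  then show ?thesis
    by simp
qed

lemma integral_indicator_shift_neg: "(\<integral>y. indicator {..<0} (x - y) \<partial>\<mu>) = surv x"
  by (subst integral_indicator_shift) (auto simp: ccdf_def intro!: arg_cong[where f="measure \<mu>"])

lemma surv_diff: "0 \<le> z \<Longrightarrow> surv (x - z) - surv x = measure \<mu> {x - z<..x}"
  unfolding ccdf_def
  by (subst finite_measure_Diff[symmetric]) (auto intro!: arg_cong[where f="measure \<mu>"])

text \<open>A jump over \<open>x - z\<close> is almost surely a jump over \<open>x\<close>, relative to the tail. In the integral for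
two summands, a first summand beyond \<open>z\<close> leaves only \<open>x - z\<close> for the second; were the tail at
\<open>x - z\<close> much larger than at \<open>x\<close>, this would push the tail of the sum above twice the tail at \<open>x\<close>.\<close>

lemma long_tailed:
  assumes "0 < e" "0 < z"
  shows "\<forall>\<^sub>F x in at_top. surv (x - z) - surv x \<le> e * surv x"
proof -
  define d where "d = e * surv z / 2"
  have d: "0 < d" using assms surv_pos[of z] by (simp add: d_def)
  have "filterlim (\<lambda>x. x - z) at_top at_top"
    by real_asymp
  then have "\<forall>\<^sub>F x in at_top. surv (x - z) < d"
    by (intro order_tendstoD(2)[OF filterlim_compose[OF surv_at_top] d])
  moreover have "\<forall>\<^sub>F x in at_top. z \<le> x"
    by (rule eventually_ge_at_top)
  ultimately show ?thesis
    using tail_2_le[OF d]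
  proof eventually_elim
    case (elim x)
    \<comment> \<open>A lower bound for the tail at x - y, by the three ranges of y up to z, up to x and beyond x.\<close>
    define g where "g y = surv x + (surv (x - z) - surv x) * indicator {z<..} y
        + (1 - surv (x - z)) * indicator {x<..} y" for y
    have "surv x + (surv (x - z) - surv x) * surv z + (1 - surv (x - z)) * surv x
        = (\<integral>y. g y \<partial>\<mu>)"
      unfolding g_def
      by (simp add: ccdf_def prob_space integrable_real_indicator less_top[symmetric])
    also have "\<dots> \<le> (\<integral>y. surv (x - y) \<partial>\<mu>)"
    proof (intro integral_mono_AE)
      show "AE y in \<mu>. g y \<le> surv (x - y)"
        using AE_pos
      proof eventually_elim
        case (elim y)
        then show ?case
          using \<open>z \<le> x\<close> surv_antimono[of "x - y" x] surv_antimono[of "x - y" "x - z"]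
          by (auto simp: g_def indicator_def tail_neg surv_neg)
      qed
    qed (auto simp: g_def integrable_real_indicator less_top[symmetric])
    also have "\<dots> = tail 2 x"
      using tail_Suc[of 1 x] by (simp add: numeral_2_eq_2 tail_1)
    also have "\<dots> \<le> (2 + d) * surv x"
      using elim by simp
    finally have "(surv (x - z) - surv x) * surv z \<le> d * surv x + surv (x - z) * surv x"
      by (simp add: algebra_simps)
    also have "surv (x - z) * surv x \<le> d * surv x"
      using elim by (intro mult_right_mono) auto
    finally have "(surv (x - z) - surv x) * surv z \<le> (e * surv x) * surv z"
      by (simp add: d_def algebra_simps)
    then show ?case
      using surv_pos[of z] by (rule mult_right_le_imp_le)
  qed
qed

text \<open>The upper half of the equivalence \<open>P(S\<^sub>k > x) \<sim> k P(B > x)\<close>, for every \<open>k\<close>. In the induction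
the bound for \<open>k\<close> summands may be used wherever the remaining level \<open>x - y\<close> is at least a constant
\<open>z\<close>. The values of \<open>y\<close> in between, within \<open>z\<close> below \<open>x\<close>, are negligible by \<open>long_tailed\<close>.\<close>

theorem tail_le_eventually:
  assumes "0 < e"
  shows "\<forall>\<^sub>F x in at_top. tail k x \<le> (real k + e) * surv x"
  using assms
proof (induction k arbitrary: e)
  case 0
  show ?case
    using eventually_ge_at_top[of 0]
    by eventually_elim (use 0 in \<open>auto simp: tail_0\<close>)
next
  case (Suc k)
  \<comment> \<open>Small enough that the error terms, a + 1 times d, stay below e / 2, where a = k + e / 2.\<close>
  define d where "d = e / (2 * (real k + 2 + e))"
  have d: "0 < d" using Suc.prems by (simp add: d_def)
  obtain z where z: "0 < z" "\<And>x. z \<le> x \<Longrightarrow> tail k x \<le> (real k + e / 2) * surv x"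
    using Suc.IH[of "e/2"] Suc.prems
    unfolding eventually_at_top_linorder
    by (meson half_gt_zero less_max_iff_disj max.bounded_iff zero_less_one)
  \<comment> \<open>Below level 0 the tail is 1 for any number of summands, so the multiple a of the tail of one
    summand overshoots there by exactly a - 1; corrected for that, the integral is about
    2 a - (a - 1) = a + 1 times the tail.\<close>
  let ?a = "real k + e / 2"
  define f where "f z' = ?a * surv z' - (?a - 1) * indicator {..<0} z' + indicator {0..<z} z'" for z'
  have f: "tail k y \<le> f y" for y
  proof (cases "y < 0")
    case True
    then show ?thesis by (simp add: f_def tail_neg surv_neg)
  next
    case False
    have "0 \<le> ?a * surv y"
      using Suc.prems by (intro mult_nonneg_nonneg) auto
    then show ?thesis
      using False z(2)[of y] tail_le_1[of k y] by (auto simp: f_def indicator_def add_increasing)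
  qed
  have bound: "tail (Suc k) x \<le> ?a * tail 2 x - (?a - 1) * surv x + (surv (x - z) - surv x)" for x
  proof -
    have "tail (Suc k) x \<le> (\<integral>y. f (x - y) \<partial>\<mu>)"
      by (rule integral_tail_le[OF f]) (auto simp: f_def)
    also have "\<dots> = ?a * (\<integral>y. surv (x - y) \<partial>\<mu>) - (?a - 1) * (\<integral>y. indicator {..<0} (x - y) \<partial>\<mu>)
        + (\<integral>y. indicator {0..<z} (x - y) \<partial>\<mu>)"
      by (simp add: f_def)
    also have "(\<integral>y. surv (x - y) \<partial>\<mu>) = tail 2 x"
      using tail_Suc[of 1 x] by (simp add: numeral_2_eq_2 tail_1)
    also have "(\<integral>y. indicator {..<0} (x - y) \<partial>\<mu>) = surv x"
      by (rule integral_indicator_shift_neg)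
    also have "(\<integral>y. indicator {0..<z} (x - y) \<partial>\<mu>) = surv (x - z) - surv x"
      using z(1) by (subst integral_indicator_shift)
        (auto simp: surv_diff intro!: arg_cong[where f="measure \<mu>"])
    finally show ?thesis .
  qed
  have "(?a + 1) * d \<le> e / 2"
  proof -
    have "(?a + 1) * d \<le> (real k + 2 + e) * d"
      using d Suc.prems by (intro mult_right_mono) auto
    also have "\<dots> = e / 2"
      using Suc.prems by (simp add: d_def field_simps)
    finally show ?thesis .
  qed
  from tail_2_le[OF d] long_tailed[OF d z(1)] show ?case
  proof eventually_elim
    case (elim x)
    have "?a * tail 2 x \<le> ?a * ((2 + d) * surv x)"
      using Suc.prems elim by (intro mult_left_mono) auto
    then have "tail (Suc k) x \<le> (?a + 1 + (?a + 1) * d) * surv x"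
      using bound[of x] elim by (simp add: algebra_simps)
    also have "\<dots> \<le> (real (Suc k) + e) * surv x"
      using \<open>(?a + 1) * d \<le> e / 2\<close> by (intro mult_right_mono) auto
    finally show ?case .
  qed
qed

text \<open>Kesten's inequality. One more summand multiplies a bound \<open>a\<close> for the ratio of tails by at most
\<open>1 + e\<close> and adds a constant: beyond a threshold \<open>x\<^sub>0\<close> this is the bound for two summands, and below
\<open>x\<^sub>0\<close> the denominator is bounded away from \<open>0\<close>.\<close>

theorem tail_le_geometric:
  assumes "1 < c"
  shows "\<exists>K. \<forall>k x. tail k x \<le> K * c ^ k * surv x"
proof -
  define e where "e = (c - 1) / 2"
  have e: "0 < e" "c = 1 + 2 * e" using assms by (auto simp: e_def field_simps)
  obtain x0 where x0: "\<And>x. x0 \<le> x \<Longrightarrow> tail 2 x \<le> (2 + e) * surv x"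
    using tail_2_le[OF e(1)] by (auto simp: eventually_at_top_linorder)
  define L where "L = 1 / surv x0"
  define K where "K = max 1 ((1 + L) / e)"
  have L: "0 < L" by (simp add: L_def surv_pos)
  have K: "1 \<le> K" "1 + L \<le> e * K"
    using e by (auto simp: K_def field_simps max_def)
  have "tail k x \<le> K * c ^ k * surv x" for k x
  proof (induction k arbitrary: x)
    case 0
    have "1 \<le> K * surv x" if "x < 0"
      using that K by (simp add: tail_neg surv_neg)
    then show ?case
      using K by (auto simp: tail_0)
  next
    case (Suc k)
    define a where "a = K * c ^ k"
    have ck: "1 \<le> c ^ k" using assms by simp
    have a: "1 \<le> a" "1 + L \<le> e * a"
    proof -
      show "1 \<le> a" unfolding a_def using K ck by (metis mult_mono mult_1 zero_le_one order_trans)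
      have "e * K * 1 \<le> e * K * c ^ k" using K e ck L by (intro mult_left_mono) auto
      then show "1 + L \<le> e * a" using K by (simp add: a_def)
    qed
    \<comment> \<open>Both sides equal 1 below level 0; without the correction a would double in each step.\<close>
    have f: "tail k y \<le> a * surv y - (a - 1) * indicator {..<0} y" for y
      using Suc.IH[of y] by (auto simp: a_def[symmetric] indicator_def tail_neg surv_neg)
    have "tail (Suc k) x \<le> (\<integral>y. a * surv (x - y) - (a - 1) * indicator {..<0} (x - y) \<partial>\<mu>)"
      by (rule integral_tail_le[OF f]) auto
    also have "\<dots> = a * (\<integral>y. surv (x - y) \<partial>\<mu>) - (a - 1) * (\<integral>y. indicator {..<0} (x - y) \<partial>\<mu>)"
      by simp
    also have "(\<integral>y. surv (x - y) \<partial>\<mu>) = tail 2 x"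
      using tail_Suc[of 1 x] by (simp add: numeral_2_eq_2 tail_1)
    also have "(\<integral>y. indicator {..<0} (x - y) \<partial>\<mu>) = surv x"
      by (rule integral_indicator_shift_neg)
    finally have *: "tail (Suc k) x \<le> a * tail 2 x - (a - 1) * surv x" .
    have "tail (Suc k) x \<le> ((1 + e) * a + (1 + L)) * surv x"
    proof (cases "x0 \<le> x")
      case True
      have "a * tail 2 x \<le> a * ((2 + e) * surv x)"
        using x0[OF True] a by (intro mult_left_mono) auto
      moreover have "0 \<le> L * surv x"
        using L by simp
      ultimately show ?thesis
        using * by (simp add: algebra_simps)
    next
      case False
      have "tail (Suc k) x \<le> L * surv x0"
        using surv_pos[of x0] by (simp add: L_def)
      also have "\<dots> \<le> L * surv x"
        using L False by (intro mult_left_mono surv_antimono) auto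
      also have "\<dots> \<le> ((1 + e) * a + (1 + L)) * surv x"
        using a e by (intro mult_right_mono) auto
      finally show ?thesis .
    qed
    also have "\<dots> \<le> (c * a) * surv x"
      using a(2) e(2) by (intro mult_right_mono) (auto simp: algebra_simps)
    finally show ?case
      by (simp add: a_def algebra_simps)
  qed
  then show ?thesis by blast
qed

end

section \<open>Sums truncated at the level to be exceeded\<close>

lemma (in prob_space) integrable_of_bool [simp]: "Measurable.pred M P \<Longrightarrow> integrable M (\<lambda>\<omega>. of_bool (P \<omega>) :: real)"
  by (rule integrable_const_bound[where B=1]) auto

lemma (in prob_space) expectation_of_bool: "(\<integral>\<omega>. of_bool (P \<omega>) \<partial>M :: real) = prob {\<omega> \<in> space M. P \<omega>}"
  if [measurable]: "Measurable.pred M P"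
proof -
  have "(\<integral>\<omega>. of_bool (P \<omega>) \<partial>M) = (\<integral>\<omega>. indicator {\<omega> \<in> space M. P \<omega>} \<omega> \<partial>M :: real)"
    by (intro Bochner_Integration.integral_cong) (auto simp: indicator_def)
  then show ?thesis by simp
qed

context positive_law
begin

text \<open>A bound for the probability that \<open>k\<close> independent variables of law \<open>\<mu>\<close> have a sum above \<open>C\<close> after
deletion of all summands above \<open>C\<close>. The first two terms are the probability that the full sum exceeds
\<open>C\<close> minus the expected number of summands above \<open>C\<close>; the last corrects for summands above
\<open>C\<close> whose complement exceeds \<open>C\<close> too.\<close>

definition excess :: "nat \<Rightarrow> real \<Rightarrow> real" where
  "excess k C = max 0 (tail k C - real k * surv C + real k * surv C * tail (k - 1) C)"

lemma excess_nonneg [simp]: "0 \<le> excess k C"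
  by (simp add: excess_def)

text \<open>Count the summands above \<open>C\<close>, plus one if the truncated sum exceeds \<open>C\<close>. If this count is at
least \<open>2\<close>, every summand above \<open>C\<close> leaves a complementary sum above \<open>C\<close>: the complement contains
another large summand or dominates the truncated sum. So pathwise the count is at most \<open>1\<close>
(only if the full sum exceeds \<open>C\<close>) plus the number of summands above \<open>C\<close> with complement above
\<open>C\<close>, and the claim follows by taking expectations.\<close>

lemma prob_truncated_sum_gt:
  fixes X :: "'i \<Rightarrow> 'a \<Rightarrow> real"
  assumes "prob_space M" and A: "finite A" and indep: "prob_space.indep_vars M (\<lambda>_. borel) X A"
    and law: "\<And>i. i \<in> A \<Longrightarrow> distr M borel (X i) = \<mu>"
    and nonneg: "\<And>i. i \<in> A \<Longrightarrow> AE \<omega> in M. 0 \<le> X i \<omega>"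
  shows "measure M {\<omega> \<in> space M. C < (\<Sum>i\<in>A. if X i \<omega> \<le> C then X i \<omega> else 0)} \<le> excess (card A) C"
proof -
  interpret M: prob_space M by fact
  have X [measurable]: "X i \<in> borel_measurable M" if "i \<in> A" for i
    using indep that by (auto simp: M.indep_vars_def)
  define T where "T \<omega> = (\<Sum>i\<in>A. if X i \<omega> \<le> C then X i \<omega> else 0)" for \<omega>
  define S where "S J \<omega> = (\<Sum>i\<in>J. X i \<omega>)" for J \<omega>
  have [measurable]: "T \<in> borel_measurable M" "J \<subseteq> A \<Longrightarrow> S J \<in> borel_measurable M" for J
    unfolding T_def[abs_def] S_def[abs_def] by (auto intro!: borel_measurable_sum)
  have pairs: "M.prob {\<omega> \<in> space M. C < X i \<omega> \<and> C < S (A - {i}) \<omega>} = surv C * tail (card A - 1) C"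
    if i: "i \<in> A" for i
  proof -
    have "M.indep_var borel (X i) borel (S (A - {i}))"
      unfolding S_def using A i indep by (intro M.indep_vars_sum) (auto simp: insert_absorb)
    then have "M.prob ((\<lambda>x. (X i x, S (A - {i}) x)) -` ({C<..} \<times> {C<..}) \<inter> space M)
        = M.prob (X i -` {C<..} \<inter> space M) * M.prob (S (A - {i}) -` {C<..} \<inter> space M)"
      by (rule M.indep_varD) auto
    moreover have "M.prob (X i -` {C<..} \<inter> space M) = surv C"
      unfolding ccdf_def law[OF i, symmetric] using i by (subst measure_distr) auto
    moreover have "M.prob (S (A - {i}) -` {C<..} \<inter> space M) = tail (card A - 1) C"
    proof -
      have "M.prob {\<omega> \<in> space M. C < (\<Sum>j\<in>A - {i}. X j \<omega>)} = tail (card (A - {i})) C"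
        using A law indep by (intro M.prob_sum_iid_gt) (auto intro: M.indep_vars_subset)
      moreover have "S (A - {i}) -` {C<..} \<inter> space M = {\<omega> \<in> space M. C < (\<Sum>j\<in>A - {i}. X j \<omega>)}"
        by (auto simp: S_def)
      ultimately show ?thesis using A i by simp
    qed
    moreover have "{\<omega> \<in> space M. C < X i \<omega> \<and> C < S (A - {i}) \<omega>}
        = (\<lambda>x. (X i x, S (A - {i}) x)) -` ({C<..} \<times> {C<..}) \<inter> space M"
      by auto
    ultimately show ?thesis by simp
  qed
  have single: "M.prob {\<omega> \<in> space M. C < X i \<omega>} = surv C" if "i \<in> A" for i
    unfolding ccdf_def law[OF that, symmetric] using that
    by (subst measure_distr) (auto intro!: arg_cong[where f="M.prob"])
  have total: "M.prob {\<omega> \<in> space M. C < S A \<omega>} = tail (card A) C"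
    unfolding S_def using A law indep by (intro M.prob_sum_iid_gt) auto
  have exceedances: "(\<Sum>i\<in>A. of_bool (C < X i \<omega>)) + of_bool (C < T \<omega>)
      \<le> of_bool (C < S A \<omega>) + (\<Sum>i\<in>A. of_bool (C < X i \<omega> \<and> C < S (A - {i}) \<omega>) :: real)"
    if nn: "\<forall>i\<in>A. 0 \<le> X i \<omega>" for \<omega>
  proof -
    define V where "V = {i \<in> A. C < X i \<omega>}"
    have V: "V \<subseteq> A" "finite V" using A by (auto simp: V_def)
    have lhs: "(\<Sum>i\<in>A. of_bool (C < X i \<omega>)) = real (card V)"
      using A by (simp add: V_def of_bool_def sum.If_cases Int_def)
    have TS: "T \<omega> \<le> S A \<omega>"
      unfolding T_def S_def using nn by (intro sum_mono) auto
    have T_le: "T \<omega> \<le> S (A - {i}) \<omega>" if "i \<in> V" for i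
    proof -
      have "T \<omega> = (\<Sum>j\<in>A - {i}. if X j \<omega> \<le> C then X j \<omega> else 0)"
        unfolding T_def using A that by (subst sum.remove[of _ i]) (auto simp: V_def)
      also have "\<dots> \<le> S (A - {i}) \<omega>"
        unfolding S_def using nn by (intro sum_mono) auto
      finally show ?thesis .
    qed
    have other: "C < S (A - {i}) \<omega>" if "j \<in> V" "j \<noteq> i" for i j
    proof -
      have "X j \<omega> \<le> S (A - {i}) \<omega>"
        unfolding S_def using that A nn by (intro member_le_sum) (auto simp: V_def)
      then show ?thesis using that by (auto simp: V_def)
    qed
    have all: "(\<Sum>i\<in>A. of_bool (C < X i \<omega> \<and> C < S (A - {i}) \<omega>)) = real (card V)"
      if "\<And>i. i \<in> V \<Longrightarrow> C < S (A - {i}) \<omega>"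
    proof -
      have "(\<Sum>i\<in>A. of_bool (C < X i \<omega> \<and> C < S (A - {i}) \<omega>)) = (\<Sum>i\<in>A. of_bool (C < X i \<omega>) :: real)"
        using that by (intro sum.cong) (auto simp: V_def)
      then show ?thesis using lhs by simp
    qed
    have SA: "C < S A \<omega>" if "i \<in> V" for i
    proof -
      have "X i \<omega> \<le> S A \<omega>"
        unfolding S_def using that A nn by (intro member_le_sum) (auto simp: V_def)
      then show ?thesis using that by (auto simp: V_def)
    qed
    show ?thesis
    proof (cases "V = {}")
      case True
      then show ?thesis using lhs TS by (auto intro!: sum_nonneg add_nonneg_nonneg)
    next
      case False
      then obtain i where i: "i \<in> V" by auto
      show ?thesis
      proof (cases "C < T \<omega> \<or> V \<noteq> {i}")
        case True
        have "C < S (A - {j}) \<omega>" if "j \<in> V" for j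
          using True
        proof
          assume "C < T \<omega>"
          then show ?thesis using T_le[OF that] by simp
        next
          assume "V \<noteq> {i}"
          then obtain l where "l \<in> V" "l \<noteq> j" using i that by blast
          then show ?thesis using other by auto
        qed
        from all[OF this] show ?thesis using lhs SA[OF i] by simp
      next
        case False
        then show ?thesis using lhs SA[OF i] by (auto intro!: sum_nonneg)
      qed
    qed
  qed
  have "AE \<omega> in M. \<forall>i\<in>A. 0 \<le> X i \<omega>"
    by (rule AE_finite_allI[OF A nonneg])
  then have "AE \<omega> in M. (\<Sum>i\<in>A. of_bool (C < X i \<omega>)) + of_bool (C < T \<omega>)
      \<le> of_bool (C < S A \<omega>) + (\<Sum>i\<in>A. of_bool (C < X i \<omega> \<and> C < S (A - {i}) \<omega>) :: real)"
    by eventually_elim (rule exceedances)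
  then have "(\<integral>\<omega>. (\<Sum>i\<in>A. of_bool (C < X i \<omega>)) + of_bool (C < T \<omega>) \<partial>M)
      \<le> (\<integral>\<omega>. of_bool (C < S A \<omega>) + (\<Sum>i\<in>A. of_bool (C < X i \<omega> \<and> C < S (A - {i}) \<omega>) :: real) \<partial>M)"
    by (intro integral_mono_AE Bochner_Integration.integrable_add Bochner_Integration.integrable_sum M.integrable_of_bool) auto
  then have "real (card A) * surv C + M.prob {\<omega> \<in> space M. C < T \<omega>}
      \<le> tail (card A) C + real (card A) * (surv C * tail (card A - 1) C)"
    by (simp add: M.expectation_of_bool single pairs total del: sum_of_bool_eq)
  then show ?thesis
    by (simp add: excess_def T_def algebra_simps)
qed

end

context subexponential_law
begin

lemma excess_negligible: "((\<lambda>C. excess k C / surv C) \<longlongrightarrow> 0) at_top"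
proof (rule tendstoI)
  fix e :: real assume e: "0 < e"
  define d where "d = e / (2 * (real k + 1))"
  have d: "0 < d" "real k * d < e / 2" using e by (auto simp: d_def field_simps)
  have "\<forall>\<^sub>F C in at_top. tail (k - 1) C < d"
    using order_tendstoD(2)[OF tail_at_top, of d] d by simp
  moreover have "\<forall>\<^sub>F C in at_top. tail k C \<le> (real k + e / 2) * surv C"
    using e by (intro tail_le_eventually) auto
  ultimately show "\<forall>\<^sub>F C in at_top. dist (excess k C / surv C) 0 < e"
  proof eventually_elim
    case (elim C)
    have "real k * surv C * tail (k - 1) C \<le> real k * surv C * d"
      using elim by (intro mult_left_mono) auto
    then have "tail k C - real k * surv C + real k * surv C * tail (k - 1) C \<le> (e / 2 + real k * d) * surv C"
      using elim by (simp add: algebra_simps)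
    also have "\<dots> < e * surv C"
      using d surv_pos by (intro mult_strict_right_mono) auto
    finally have "excess k C < e * surv C"
      using e surv_pos[of C] by (simp add: excess_def)
    then show ?case
      using surv_pos[of C] by (simp add: field_simps)
  qed
qed

lemma excess_le_geometric:
  assumes "1 < c"
  shows "\<exists>K. \<forall>k C. excess k C \<le> K * c ^ k * surv C"
proof -
  obtain K where K: "\<And>k C. tail k C \<le> K * c ^ k * surv C"
    using tail_le_geometric[OF assms] by blast
  have "excess k C \<le> (K + 1 / (c - 1)) * c ^ k * surv C" for k C
  proof -
    have "1 + real k * (c - 1) \<le> c ^ k"
      using Bernoulli_inequality[of "c - 1" k] assms by simp
    then have "real k \<le> c ^ k / (c - 1)"
      using assms by (simp add: field_simps)
    then have "real k * surv C \<le> c ^ k / (c - 1) * surv C"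
      by (intro mult_right_mono) auto
    moreover have "real k * surv C * tail (k - 1) C \<le> real k * surv C * 1"
      by (intro mult_left_mono) auto
    moreover have "0 \<le> real k * surv C" "0 \<le> tail k C" by simp_all
    moreover have "K * c ^ k * surv C + c ^ k / (c - 1) * surv C = (K + 1 / (c - 1)) * c ^ k * surv C"
      by (simp add: algebra_simps)
    ultimately show ?thesis
      using K[of k C] unfolding excess_def by (intro max.boundedI; linarith)
  qed
  then show ?thesis by blast
qed

end

section \<open>Exponential moments of the number of unfinished requests\<close>

lemma sum_count_multiples_le:
  fixes b x :: real
  assumes "0 < b" "0 \<le> x"
  shows "(\<Sum>k<m. of_bool (b * (real k + 1) < x)) \<le> x / b"
proof (induction m)
  case (Suc m)
  show ?case
  proof (cases "b * (real m + 1) < x")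
    case True
    have "(\<Sum>k<Suc m. of_bool (b * (real k + 1) < x)) \<le> (\<Sum>k<Suc m. 1 :: real)"
      by (intro sum_mono) auto
    also have "\<dots> \<le> x / b"
      using True assms by (simp add: field_simps)
    finally show ?thesis .
  qed (use Suc in simp)
qed (use assms in auto)

lemma power_card_eq_prod:
  "finite A \<Longrightarrow> c ^ card {k \<in> A. P k} = (\<Prod>k\<in>A. if P k then c else (1 :: real))"
  by (simp add: prod.If_cases Int_def)

text \<open>The size of a nonempty finite set of natural numbers is at most the successor of its largest element.\<close>

lemma power_card_le_sum:
  fixes c :: real
  assumes "1 \<le> c"
  shows "c ^ card {k. k < m \<and> P k} \<le> 1 + (\<Sum>k<m. c ^ Suc k * of_bool (P k))"
proof (induction m)
  case (Suc m)
  show ?case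
  proof (cases "P m")
    case True
    have "card {k. k < Suc m \<and> P k} \<le> card {..<Suc m}"
      by (intro card_mono) auto
    then have "c ^ card {k. k < Suc m \<and> P k} \<le> c ^ Suc m"
      using assms by (intro power_increasing) auto
    moreover have "0 \<le> (\<Sum>k<m. c ^ Suc k * of_bool (P k))"
      using assms by (intro sum_nonneg) auto
    ultimately show ?thesis
      using True by simp
  next
    case False
    then have "{k. k < Suc m \<and> P k} = {k. k < m \<and> P k}"
      by (auto simp: less_Suc_eq)
    then show ?thesis using Suc False by simp
  qed
qed simp

context prob_space
begin

text \<open>The events \<open>b * (k + 1) < X k\<close> are independent with summable probabilities, the sum being at
most the mean divided by \<open>b\<close>. The generating function of their number factorizes and is at most
\<open>exp\<close> of \<open>c - 1\<close> times that sum.\<close>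

lemma exp_moment_count_large:
  fixes X :: "nat \<Rightarrow> 'a \<Rightarrow> real"
  assumes indep: "indep_vars (\<lambda>_. borel) X UNIV" and law: "\<And>k. distr M borel (X k) = distr M borel (X 0)"
    and nonneg: "AE \<omega> in M. 0 \<le> X 0 \<omega>" and int: "integrable M (X 0)" and b: "0 < b" and c: "1 \<le> c"
  shows "(\<integral>\<^sup>+\<omega>. ennreal (c ^ card {k. k < m \<and> b * (real k + 1) < X k \<omega>}) \<partial>M)
      \<le> ennreal (exp ((c - 1) * (expectation (X 0) / b)))"
proof -
  have X [measurable]: "X k \<in> borel_measurable M" for k
    using indep by (auto simp: indep_vars_def)
  define p where "p k = prob {\<omega> \<in> space M. b * (real k + 1) < X k \<omega>}" for k
  have p: "p k = prob {\<omega> \<in> space M. b * (real k + 1) < X 0 \<omega>}" for k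
  proof -
    have "p k = measure (distr M borel (X k)) {b * (real k + 1)<..}"
      unfolding p_def by (subst measure_distr) (auto intro!: arg_cong[where f=prob])
    also have "\<dots> = prob {\<omega> \<in> space M. b * (real k + 1) < X 0 \<omega>}"
      unfolding law[of k] by (subst measure_distr) (auto intro!: arg_cong[where f=prob])
    finally show ?thesis .
  qed
  have "(\<Sum>k<m. p k) = expectation (\<lambda>\<omega>. \<Sum>k<m. of_bool (b * (real k + 1) < X 0 \<omega>))"
    by (subst Bochner_Integration.integral_sum) (auto simp: p expectation_of_bool simp del: sum_of_bool_eq)
  also have "\<dots> \<le> expectation (\<lambda>\<omega>. X 0 \<omega> / b)"
  proof (intro integral_mono_AE)
    show "AE \<omega> in M. (\<Sum>k<m. of_bool (b * (real k + 1) < X 0 \<omega>)) \<le> X 0 \<omega> / b"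
      using nonneg by eventually_elim (rule sum_count_multiples_le[OF b])
  qed (use int in \<open>auto intro!: Bochner_Integration.integrable_sum simp del: sum_of_bool_eq\<close>)
  finally have sum_p: "(\<Sum>k<m. p k) \<le> expectation (X 0) / b" by simp
  have "(\<integral>\<^sup>+\<omega>. ennreal (c ^ card {k. k < m \<and> b * (real k + 1) < X k \<omega>}) \<partial>M)
      = (\<integral>\<^sup>+\<omega>. (\<Prod>k<m. ennreal (if b * (real k + 1) < X k \<omega> then c else 1)) \<partial>M)"
  proof (intro nn_integral_cong)
    fix \<omega>
    have "c ^ card {k. k < m \<and> b * (real k + 1) < X k \<omega>}
        = (\<Prod>k<m. if b * (real k + 1) < X k \<omega> then c else 1)"
      using power_card_eq_prod[of "{..<m}" c "\<lambda>k. b * (real k + 1) < X k \<omega>"] by simp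
    then show "ennreal (c ^ card {k. k < m \<and> b * (real k + 1) < X k \<omega>})
        = (\<Prod>k<m. ennreal (if b * (real k + 1) < X k \<omega> then c else 1))"
      using c by (simp add: prod_ennreal)
  qed
  also have "\<dots> = (\<Prod>k<m. \<integral>\<^sup>+\<omega>. ennreal (if b * (real k + 1) < X k \<omega> then c else 1) \<partial>M)"
  proof (rule indep_vars_nn_integral)
    have "indep_vars (\<lambda>_. borel) (\<lambda>k \<omega>. (\<lambda>x. ennreal (if b * (real k + 1) < x then c else 1)) (X k \<omega>)) UNIV"
      by (rule indep_vars_compose2[OF indep]) auto
    then show "indep_vars (\<lambda>_. borel) (\<lambda>k \<omega>. ennreal (if b * (real k + 1) < X k \<omega> then c else 1)) {..<m}"
      by (auto intro: indep_vars_subset)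
  qed auto
  also have "\<dots> = (\<Prod>k<m. ennreal (1 + (c - 1) * p k))"
  proof (intro prod.cong refl)
    fix k
    have "(\<integral>\<^sup>+\<omega>. ennreal (if b * (real k + 1) < X k \<omega> then c else 1) \<partial>M)
        = (\<integral>\<^sup>+\<omega>. ennreal (1 + (c - 1) * of_bool (b * (real k + 1) < X k \<omega>)) \<partial>M)"
      by (intro nn_integral_cong) auto
    also have "\<dots> = ennreal (\<integral>\<omega>. 1 + (c - 1) * of_bool (b * (real k + 1) < X k \<omega>) \<partial>M)"
      using c by (intro nn_integral_eq_integral) auto
    also have "(\<integral>\<omega>. 1 + (c - 1) * of_bool (b * (real k + 1) < X k \<omega>) \<partial>M) = 1 + (c - 1) * p k"
      by (simp add: p_def expectation_of_bool prob_space)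
    finally show "(\<integral>\<^sup>+\<omega>. ennreal (if b * (real k + 1) < X k \<omega> then c else 1) \<partial>M) = ennreal (1 + (c - 1) * p k)" .
  qed
  also have "\<dots> = ennreal (\<Prod>k<m. 1 + (c - 1) * p k)"
    using c by (intro prod_ennreal) (auto simp: p_def)
  also have "\<dots> \<le> ennreal (exp ((c - 1) * (expectation (X 0) / b)))"
  proof (rule ennreal_leI)
    have "(\<Prod>k<m. 1 + (c - 1) * p k) \<le> (\<Prod>k<m. exp ((c - 1) * p k))"
      using c by (intro prod_mono) (auto simp: p_def)
    also have "\<dots> = exp ((c - 1) * (\<Sum>k<m. p k))"
      by (simp add: exp_sum sum_distrib_left)
    also have "\<dots> \<le> exp ((c - 1) * (expectation (X 0) / b))"
      unfolding exp_le_cancel_iff using c by (intro mult_left_mono sum_p) auto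
    finally show "(\<Prod>k<m. 1 + (c - 1) * p k) \<le> exp ((c - 1) * (expectation (X 0) / b))" .
  qed
  finally show ?thesis .
qed

text \<open>Chernoff's bound for the lower deviations. A nonnegative increment that is not almost surely \<open>0\<close>
has \<open>E exp (- T) = 1 - 2 u\<close> with \<open>u > 0\<close>, and \<open>1 - 2 u \<le> exp (- 2 u)\<close>; half of this rate is given up
to the factor \<open>exp (u k)\<close> from Markov's inequality.\<close>

lemma prob_slow_random_walk:
  fixes T :: "nat \<Rightarrow> 'a \<Rightarrow> real"
  assumes indep: "indep_vars (\<lambda>_. borel) T UNIV" and law: "\<And>k. distr M borel (T k) = distr M borel (T 0)"
    and nonneg: "AE \<omega> in M. 0 \<le> T 0 \<omega>" and int: "integrable M (T 0)" and mean: "0 < expectation (T 0)"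
  shows "\<exists>u>0. \<forall>k. prob {\<omega> \<in> space M. (\<Sum>j<k. T j \<omega>) \<le> u * real k} \<le> exp (- u * real k)"
proof -
  have T [measurable]: "T k \<in> borel_measurable M" for k
    using indep by (auto simp: indep_vars_def)
  have iexp: "integrable M (\<lambda>\<omega>. exp (- T 0 \<omega>))"
    by (rule integrable_const_bound[where B=1]) (use nonneg in auto)
  define phi where "phi = expectation (\<lambda>\<omega>. exp (- T 0 \<omega>))"
  have phi: "phi < 1"
  proof -
    have "0 \<le> expectation (\<lambda>\<omega>. 1 - exp (- T 0 \<omega>))"
      using nonneg by (intro integral_nonneg_AE) auto
    moreover have "expectation (\<lambda>\<omega>. 1 - exp (- T 0 \<omega>)) \<noteq> 0"
    proof
      assume "expectation (\<lambda>\<omega>. 1 - exp (- T 0 \<omega>)) = 0"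
      then have "AE \<omega> in M. 1 - exp (- T 0 \<omega>) = 0"
        using nonneg iexp by (subst (asm) integral_nonneg_eq_0_iff_AE) auto
      then have "AE \<omega> in M. T 0 \<omega> = 0" by auto
      then have "expectation (T 0) = expectation (\<lambda>_. 0)"
        by (intro integral_cong_AE) auto
      then show False using mean by simp
    qed
    moreover have "expectation (\<lambda>\<omega>. 1 - exp (- T 0 \<omega>)) = 1 - phi"
      using iexp by (simp add: phi_def prob_space)
    ultimately show ?thesis by simp
  qed
  define u where "u = (1 - phi) / 2"
  have u: "0 < u" using phi by (simp add: u_def)
  have phi_le: "phi \<le> exp (- 2 * u)"
  proof -
    have "- 2 * u = phi - 1" by (simp add: u_def field_simps)
    then show ?thesis
      using exp_ge_add_one_self[of "phi - 1"] by simp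
  qed
  have phi0: "0 \<le> phi" by (simp add: phi_def)
  have "prob {\<omega> \<in> space M. (\<Sum>j<k. T j \<omega>) \<le> u * real k} \<le> exp (- u * real k)" for k
  proof -
    have "ennreal (prob {\<omega> \<in> space M. (\<Sum>j<k. T j \<omega>) \<le> u * real k})
        = (\<integral>\<^sup>+\<omega>. indicator {\<omega> \<in> space M. (\<Sum>j<k. T j \<omega>) \<le> u * real k} \<omega> \<partial>M)"
      by (simp add: emeasure_eq_measure)
    also have "\<dots> \<le> (\<integral>\<^sup>+\<omega>. ennreal (exp (u * real k)) * (\<Prod>j<k. ennreal (exp (- T j \<omega>))) \<partial>M)"
    proof (intro nn_integral_mono)
      fix \<omega>
      have "(\<Prod>j<k. ennreal (exp (- T j \<omega>))) = ennreal (exp (- (\<Sum>j<k. T j \<omega>)))"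
        by (simp add: prod_ennreal exp_sum sum_negf[symmetric])
      then have "ennreal (exp (u * real k)) * (\<Prod>j<k. ennreal (exp (- T j \<omega>)))
          = ennreal (exp (u * real k - (\<Sum>j<k. T j \<omega>)))"
        by (simp add: ennreal_mult[symmetric] exp_add[symmetric])
      then show "indicator {\<omega> \<in> space M. (\<Sum>j<k. T j \<omega>) \<le> u * real k} \<omega>
          \<le> ennreal (exp (u * real k)) * (\<Prod>j<k. ennreal (exp (- T j \<omega>)))"
        by (auto simp: indicator_def)
    qed
    also have "\<dots> = ennreal (exp (u * real k)) * (\<integral>\<^sup>+\<omega>. (\<Prod>j<k. ennreal (exp (- T j \<omega>))) \<partial>M)"
      by (intro nn_integral_cmult) measurable
    also have "(\<integral>\<^sup>+\<omega>. (\<Prod>j<k. ennreal (exp (- T j \<omega>))) \<partial>M) = (\<Prod>j<k. \<integral>\<^sup>+\<omega>. ennreal (exp (- T j \<omega>)) \<partial>M)"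
    proof (rule indep_vars_nn_integral)
      have "indep_vars (\<lambda>_. borel) (\<lambda>j \<omega>. (\<lambda>x. ennreal (exp (- x))) (T j \<omega>)) UNIV"
        by (rule indep_vars_compose2[OF indep]) auto
      then show "indep_vars (\<lambda>_. borel) (\<lambda>j \<omega>. ennreal (exp (- T j \<omega>))) {..<k}"
        by (auto intro: indep_vars_subset)
    qed auto
    also have "\<dots> = (\<Prod>j<k. ennreal phi)"
    proof (intro prod.cong refl)
      fix j
      have "(\<integral>\<^sup>+\<omega>. ennreal (exp (- T j \<omega>)) \<partial>M) = (\<integral>\<^sup>+x. ennreal (exp (- x)) \<partial>distr M borel (T j))"
        by (subst nn_integral_distr) auto
      also have "\<dots> = (\<integral>\<^sup>+\<omega>. ennreal (exp (- T 0 \<omega>)) \<partial>M)"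
        unfolding law[of j] by (subst nn_integral_distr) auto
      also have "\<dots> = ennreal phi"
        unfolding phi_def using iexp by (intro nn_integral_eq_integral) auto
      finally show "(\<integral>\<^sup>+\<omega>. ennreal (exp (- T j \<omega>)) \<partial>M) = ennreal phi" .
    qed
    also have "\<dots> = ennreal (phi ^ k)"
      using phi0 by (simp add: ennreal_power)
    also have "ennreal (exp (u * real k)) * ennreal (phi ^ k) = ennreal (exp (u * real k) * phi ^ k)"
      using phi0 by (simp add: ennreal_mult)
    also have "\<dots> \<le> ennreal (exp (u * real k) * exp (- 2 * u) ^ k)"
      using phi0 phi_le by (intro ennreal_leI mult_left_mono power_mono) auto
    also have "exp (u * real k) * exp (- 2 * u) ^ k = exp (- u * real k)"
      by (simp add: exp_of_nat_mult[symmetric] exp_add[symmetric] algebra_simps)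
    finally show ?thesis by simp
  qed
  with u show ?thesis by blast
qed

lemma exp_moment_count_slow:
  fixes S :: "nat \<Rightarrow> 'a \<Rightarrow> real"
  assumes [measurable]: "\<And>k. S k \<in> borel_measurable M" and u: "0 < u"
    and slow: "\<And>k. prob {\<omega> \<in> space M. S k \<omega> \<le> a k} \<le> exp (- u * (real k + 1))"
  shows "(\<integral>\<^sup>+\<omega>. ennreal (exp (u / 2) ^ card {k. k < m \<and> S k \<omega> \<le> a k}) \<partial>M)
      \<le> ennreal (1 + 1 / (1 - exp (- u / 2)))"
proof -
  define c where "c = exp (u / 2)"
  define q where "q = exp (- u / 2)"
  have c: "1 \<le> c" and q: "0 < q" "q < 1" using u by (auto simp: c_def q_def)
  have int: "integrable M (\<lambda>\<omega>. \<Sum>k<m. c ^ Suc k * of_bool (S k \<omega> \<le> a k))"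
    by (intro Bochner_Integration.integrable_sum integrable_mult_right integrable_of_bool) measurable
  have "(\<integral>\<^sup>+\<omega>. ennreal (c ^ card {k. k < m \<and> S k \<omega> \<le> a k}) \<partial>M)
      \<le> (\<integral>\<^sup>+\<omega>. ennreal (1 + (\<Sum>k<m. c ^ Suc k * of_bool (S k \<omega> \<le> a k))) \<partial>M)"
    by (intro nn_integral_mono ennreal_leI power_card_le_sum c)
  also have "\<dots> = ennreal (\<integral>\<omega>. 1 + (\<Sum>k<m. c ^ Suc k * of_bool (S k \<omega> \<le> a k)) \<partial>M)"
    using c by (intro nn_integral_eq_integral Bochner_Integration.integrable_add int AE_I2
        add_nonneg_nonneg sum_nonneg) auto
  also have "(\<integral>\<omega>. 1 + (\<Sum>k<m. c ^ Suc k * of_bool (S k \<omega> \<le> a k)) \<partial>M)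
      = 1 + (\<Sum>k<m. c ^ Suc k * prob {\<omega> \<in> space M. S k \<omega> \<le> a k})"
    by (subst Bochner_Integration.integral_add[OF _ int], simp, subst Bochner_Integration.integral_sum)
      (auto simp: prob_space expectation_of_bool)
  also have "\<dots> \<le> 1 + 1 / (1 - q)"
  proof -
    have "(\<Sum>k<m. c ^ Suc k * prob {\<omega> \<in> space M. S k \<omega> \<le> a k}) \<le> (\<Sum>k<m. q ^ k)"
    proof (intro sum_mono)
      fix k
      have "c ^ Suc k * prob {\<omega> \<in> space M. S k \<omega> \<le> a k} \<le> c ^ Suc k * exp (- u * (real k + 1))"
        using c by (intro mult_left_mono slow) auto
      also have "\<dots> = q ^ Suc k"
        by (simp add: c_def q_def exp_of_nat_mult[symmetric] exp_add[symmetric] field_simps del: power_Suc)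
      also have "\<dots> \<le> q ^ k"
        using q by (simp add: mult_left_le_one_le)
      finally show "c ^ Suc k * prob {\<omega> \<in> space M. S k \<omega> \<le> a k} \<le> q ^ k" .
    qed
    also have "\<dots> = (1 - q ^ m) / (1 - q)"
      using q by (simp add: sum_gp_strict)
    also have "\<dots> \<le> 1 / (1 - q)"
      using q by (intro divide_right_mono) auto
    finally show ?thesis by simp
  qed
  finally show ?thesis
    by (simp add: c_def q_def ennreal_leI)
qed

text \<open>Read \<open>T\<close> as interarrival times and \<open>X k + Y k\<close> as the sojourn of the customer that arrived
\<open>k + 1\<close> steps ago; \<open>Z\<close> is the set of customers still present. If such a customer is present, then
either the arrival process covered at most \<open>u * (k + 1)\<close> in \<open>k + 1\<close> steps, or one of \<open>X k\<close>, \<open>Y k\<close>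
exceeds half of that. Each of the three counts has an exponential moment, and so has their sum
whatever their joint law, because \<open>c\<^bsup>i+j+l\<^esup> \<le> c\<^bsup>3i\<^esup> + c\<^bsup>3j\<^esup> + c\<^bsup>3l\<^esup>\<close>.\<close>

theorem exp_moment_count_uncovered:
  fixes T X Y :: "nat \<Rightarrow> 'a \<Rightarrow> real"
  assumes T: "indep_vars (\<lambda>_. borel) T UNIV" "\<And>k. distr M borel (T k) = distr M borel (T 0)"
      "AE \<omega> in M. 0 \<le> T 0 \<omega>" "integrable M (T 0)" "0 < expectation (T 0)"
    and X: "indep_vars (\<lambda>_. borel) X UNIV" "\<And>k. distr M borel (X k) = distr M borel (X 0)"
      "AE \<omega> in M. 0 \<le> X 0 \<omega>" "integrable M (X 0)"
    and Y: "indep_vars (\<lambda>_. borel) Y UNIV" "\<And>k. distr M borel (Y k) = distr M borel (Y 0)"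
      "AE \<omega> in M. 0 \<le> Y 0 \<omega>" "integrable M (Y 0)"
  defines "Z \<equiv> \<lambda>\<omega>. {k. (\<Sum>j\<le>k. T j \<omega>) < X k \<omega> + Y k \<omega>}"
  shows "\<exists>c>1::real. (AE \<omega> in M. finite (Z \<omega>)) \<and> integrable M (\<lambda>\<omega>. c ^ card (Z \<omega>))"
proof -
  have [measurable]: "T k \<in> borel_measurable M" "X k \<in> borel_measurable M" "Y k \<in> borel_measurable M" for k
    using T(1) X(1) Y(1) by (auto simp: indep_vars_def)
  obtain u where u: "0 < u"
    "\<And>k. prob {\<omega> \<in> space M. (\<Sum>j<k. T j \<omega>) \<le> u * real k} \<le> exp (- u * real k)"
    using prob_slow_random_walk[OF T] by blast
  \<comment> \<open>The cube of c is the base for which the count of slow arrivals has a finite moment.\<close>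
  define c where "c = exp (u / 6)"
  have c: "1 < c" and c3: "c ^ 3 = exp (u / 2)"
    using u by (auto simp: c_def exp_of_nat_mult[symmetric])
  have c3_ge: "1 \<le> c ^ 3" using c by simp
  define NT NX NY where
    "NT m \<omega> = card {k. k < m \<and> (\<Sum>j\<le>k. T j \<omega>) \<le> u * (real k + 1)}"
    and "NX m \<omega> = card {k. k < m \<and> u / 2 * (real k + 1) < X k \<omega>}"
    and "NY m \<omega> = card {k. k < m \<and> u / 2 * (real k + 1) < Y k \<omega>}" for m \<omega>
  have [measurable]: "NT m \<in> measurable M (count_space UNIV)" "NX m \<in> measurable M (count_space UNIV)"
      "NY m \<in> measurable M (count_space UNIV)" for m
    unfolding NT_def[abs_def] NX_def[abs_def] NY_def[abs_def] by measurable
  define f where "f m \<omega> = ennreal (c ^ card {k. k < m \<and> k \<in> Z \<omega>})" for m \<omega>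
  have Z [measurable]: "{\<omega> \<in> space M. k \<in> Z \<omega>} \<in> sets M" for k
    unfolding Z_def by measurable
  have [measurable]: "(\<lambda>\<omega>. card {k. k < m \<and> k \<in> Z \<omega>}) \<in> measurable M (count_space UNIV)" for m
    by (rule measurable_card) measurable
  have [measurable]: "(\<lambda>\<omega>. card (Z \<omega>)) \<in> measurable M (count_space UNIV)"
    by (rule measurable_card) measurable
  have [measurable]: "f m \<in> borel_measurable M" for m
    unfolding f_def[abs_def] by measurable
  have f_le: "f m \<omega> \<le> ennreal ((c ^ 3) ^ NT m \<omega>) + ennreal ((c ^ 3) ^ NX m \<omega>) + ennreal ((c ^ 3) ^ NY m \<omega>)"
    for m \<omega>
  proof -
    let ?A = "{k. k < m \<and> (\<Sum>j\<le>k. T j \<omega>) \<le> u * (real k + 1)}"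
    let ?B = "{k. k < m \<and> u / 2 * (real k + 1) < X k \<omega>}"
    let ?C = "{k. k < m \<and> u / 2 * (real k + 1) < Y k \<omega>}"
    have "{k. k < m \<and> k \<in> Z \<omega>} \<subseteq> ?A \<union> ?B \<union> ?C"
      by (auto simp: Z_def field_simps)
    then have "card {k. k < m \<and> k \<in> Z \<omega>} \<le> card (?A \<union> ?B \<union> ?C)"
      by (intro card_mono) auto
    also have "\<dots> \<le> NT m \<omega> + NX m \<omega> + NY m \<omega>"
      unfolding NT_def NX_def NY_def by (intro order_trans[OF card_Un_le] add_right_mono card_Un_le)
    also have "\<dots> \<le> 3 * max (NT m \<omega>) (max (NX m \<omega>) (NY m \<omega>))"
      by auto
    finally have "c ^ card {k. k < m \<and> k \<in> Z \<omega>} \<le> (c ^ 3) ^ max (NT m \<omega>) (max (NX m \<omega>) (NY m \<omega>))"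
      using c by (simp add: power_mult[symmetric])
    also have "\<dots> \<le> (c ^ 3) ^ NT m \<omega> + (c ^ 3) ^ NX m \<omega> + (c ^ 3) ^ NY m \<omega>"
      using c by (auto simp: max_def)
    finally have "f m \<omega> \<le> ennreal ((c ^ 3) ^ NT m \<omega> + (c ^ 3) ^ NX m \<omega> + (c ^ 3) ^ NY m \<omega>)"
      unfolding f_def by (rule ennreal_leI)
    then show ?thesis
      using c by simp
  qed
  define KX KY KT where "KX = exp ((c ^ 3 - 1) * (expectation (X 0) / (u / 2)))"
    and "KY = exp ((c ^ 3 - 1) * (expectation (Y 0) / (u / 2)))"
    and "KT = 1 + 1 / (1 - exp (- u / 2))"
  have int_f: "(\<integral>\<^sup>+\<omega>. f m \<omega> \<partial>M) \<le> ennreal KT + ennreal KX + ennreal KY" for m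
  proof -
    have "(\<integral>\<^sup>+\<omega>. f m \<omega> \<partial>M)
        \<le> (\<integral>\<^sup>+\<omega>. ennreal ((c ^ 3) ^ NT m \<omega>) + ennreal ((c ^ 3) ^ NX m \<omega>) + ennreal ((c ^ 3) ^ NY m \<omega>) \<partial>M)"
      by (intro nn_integral_mono f_le)
    also have "\<dots> = (\<integral>\<^sup>+\<omega>. ennreal ((c ^ 3) ^ NT m \<omega>) \<partial>M) + (\<integral>\<^sup>+\<omega>. ennreal ((c ^ 3) ^ NX m \<omega>) \<partial>M)
        + (\<integral>\<^sup>+\<omega>. ennreal ((c ^ 3) ^ NY m \<omega>) \<partial>M)"
      by (simp add: nn_integral_add)
    also have "\<dots> \<le> ennreal KT + ennreal KX + ennreal KY"
    proof (intro add_mono)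
      have "prob {\<omega> \<in> space M. (\<Sum>j\<le>k. T j \<omega>) \<le> u * (real k + 1)} \<le> exp (- u * (real k + 1))" for k
        using u(2)[of "Suc k"] by (simp add: lessThan_Suc_atMost add.commute)
      then show "(\<integral>\<^sup>+\<omega>. ennreal ((c ^ 3) ^ NT m \<omega>) \<partial>M) \<le> ennreal KT"
        unfolding NT_def KT_def c3 by (intro exp_moment_count_slow u(1)) auto
      show "(\<integral>\<^sup>+\<omega>. ennreal ((c ^ 3) ^ NX m \<omega>) \<partial>M) \<le> ennreal KX"
        unfolding NX_def KX_def using u(1) by (intro exp_moment_count_large X c3_ge) auto
      show "(\<integral>\<^sup>+\<omega>. ennreal ((c ^ 3) ^ NY m \<omega>) \<partial>M) \<le> ennreal KY"
        unfolding NY_def KY_def using u(1) by (intro exp_moment_count_large Y c3_ge) auto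
    qed
    finally show ?thesis .
  qed
  have "incseq f"
    unfolding incseq_def le_fun_def f_def using c
    by (auto intro!: ennreal_leI power_increasing card_mono)
  then have "(\<integral>\<^sup>+\<omega>. (SUP m. f m \<omega>) \<partial>M) = (SUP m. \<integral>\<^sup>+\<omega>. f m \<omega> \<partial>M)"
    by (intro nn_integral_monotone_convergence_SUP) auto
  also have "\<dots> \<le> ennreal KT + ennreal KX + ennreal KY"
    by (intro SUP_least int_f)
  also have "\<dots> < \<infinity>"
    by simp
  finally have fin: "(\<integral>\<^sup>+\<omega>. (SUP m. f m \<omega>) \<partial>M) < \<infinity>" .
  have finite_Z: "finite (Z \<omega>)" if nt: "(SUP m. f m \<omega>) \<noteq> \<infinity>" for \<omega>
  proof (rule ccontr)
    assume inf: "infinite (Z \<omega>)"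
    obtain r where r: "(SUP m. f m \<omega>) = ennreal r" "0 \<le> r"
    proof
      show "(SUP m. f m \<omega>) = ennreal (enn2real (SUP m. f m \<omega>))"
        using nt unfolding infinity_ennreal_def less_top by (rule ennreal_enn2real[symmetric])
    qed simp
    obtain l where l: "r < c ^ l"
      using real_arch_pow[OF c] by blast
    obtain B where B: "B \<subseteq> Z \<omega>" "finite B" "card B = l"
      using infinite_arbitrarily_large[OF inf, of l] by auto
    then have "B \<subseteq> {k. k < Suc (Max B) \<and> k \<in> Z \<omega>}"
      by (auto simp: less_Suc_eq_le)
    then have "l \<le> card {k. k < Suc (Max B) \<and> k \<in> Z \<omega>}"
      unfolding B(3)[symmetric] by (rule card_mono[rotated]) simp
    then have "ennreal (c ^ l) \<le> f (Suc (Max B)) \<omega>"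
      unfolding f_def using c by (intro ennreal_leI power_increasing) auto
    also have "\<dots> \<le> ennreal r"
      unfolding r(1)[symmetric] by (rule SUP_upper) simp
    finally show False
      using l r(2) by simp
  qed
  have "AE \<omega> in M. (SUP m. f m \<omega>) \<noteq> \<infinity>"
    by (rule nn_integral_PInf_AE) (use fin in auto)
  then have AE_fin: "AE \<omega> in M. finite (Z \<omega>)"
    by eventually_elim (rule finite_Z)
  have "(\<integral>\<^sup>+\<omega>. ennreal (c ^ card (Z \<omega>)) \<partial>M) \<le> (\<integral>\<^sup>+\<omega>. (SUP m. f m \<omega>) \<partial>M)"
  proof (intro nn_integral_mono_AE)
    show "AE \<omega> in M. ennreal (c ^ card (Z \<omega>)) \<le> (SUP m. f m \<omega>)"
      using AE_fin
    proof eventually_elim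
      case (elim \<omega>)
      then have "{k. k < Suc (Max (Z \<omega>)) \<and> k \<in> Z \<omega>} = Z \<omega>"
        by (auto simp: less_Suc_eq_le)
      then have "ennreal (c ^ card (Z \<omega>)) = f (Suc (Max (Z \<omega>))) \<omega>"
        by (simp add: f_def)
      then show ?case
        by (simp only:) (rule SUP_upper, simp)
    qed
  qed
  with fin have "(\<integral>\<^sup>+\<omega>. ennreal (c ^ card (Z \<omega>)) \<partial>M) < \<infinity>"
    by (rule le_less_trans[rotated])
  then have "integrable M (\<lambda>\<omega>. c ^ card (Z \<omega>))"
    using c by (intro integrableI_nonneg) auto
  with c AE_fin show ?thesis
    by (intro exI[of _ c] conjI)
qed

end

section \<open>Independence of a random index set\<close>

context prob_space
begin

lemma indep_vars_reindex:
  assumes "indep_vars M' X I" "inj_on f J" "f ` J \<subseteq> I"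
  shows "indep_vars (\<lambda>j. M' (f j)) (\<lambda>j. X (f j)) J"
proof -
  have "indep_vars (\<lambda>j. PiM {f j} M') (\<lambda>j \<omega>. restrict (\<lambda>i. X i \<omega>) {f j}) J"
    using assms(2,3) by (intro indep_vars_restrict[OF assms(1)])
      (auto simp: disjoint_family_on_def inj_on_def)
  then have "indep_vars (\<lambda>j. M' (f j)) (\<lambda>j \<omega>. (\<lambda>x. x (f j)) (restrict (\<lambda>i. X i \<omega>) {f j})) J"
    by (rule indep_vars_compose2) auto
  then show ?thesis by simp
qed

lemma iid_reindex:
  assumes "iid X" "inj f"
  shows "indep_vars (\<lambda>_. borel) (\<lambda>k::nat. X (f k)) UNIV"
    and "distr M borel (X (f k)) = distr M borel (X (f 0))"
proof -
  show "indep_vars (\<lambda>_. borel) (\<lambda>k::nat. X (f k)) UNIV"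
    using assms indep_vars_reindex[of "\<lambda>_. borel" X UNIV f UNIV] by (simp add: iid_def)
  show "distr M borel (X (f k)) = distr M borel (X (f 0))"
    using assms(1) unfolding iid_def by metis
qed

text \<open>Conditioning on a random set independent of the events \<open>P A\<close>. Since there are only
countably many finite sets, it amounts to a sum over the values of \<open>N\<close>.\<close>

lemma prob_random_set_le:
  fixes N :: "'a \<Rightarrow> nat set"
  assumes N [measurable]: "\<And>k. {\<omega> \<in> space M. k \<in> N \<omega>} \<in> events"
    and P [measurable]: "\<And>A. finite A \<Longrightarrow> Measurable.pred M (P A)"
    and indep: "\<And>A. finite A \<Longrightarrow> prob {\<omega> \<in> space M. N \<omega> = A \<and> P A \<omega>}
        = prob {\<omega> \<in> space M. N \<omega> = A} * prob {\<omega> \<in> space M. P A \<omega>}"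
    and bound: "\<And>A. finite A \<Longrightarrow> prob {\<omega> \<in> space M. P A \<omega>} \<le> g (card A)"
  shows "emeasure M {\<omega> \<in> space M. finite (N \<omega>) \<and> P (N \<omega>) \<omega>} \<le> (\<integral>\<^sup>+\<omega>. ennreal (g (card (N \<omega>))) \<partial>M)"
proof -
  let ?F = "Collect finite :: nat set set"
  have cnt: "countable ?F" by (rule countable_Collect_finite)
  have eqA [measurable]: "{\<omega> \<in> space M. N \<omega> = A} \<in> events" for A
  proof -
    have "{\<omega> \<in> space M. N \<omega> = A} = {\<omega> \<in> space M. \<forall>k. k \<in> N \<omega> \<longleftrightarrow> k \<in> A}" by auto
    also have "\<dots> \<in> events" by measurable
    finally show ?thesis .
  qed
  have ev: "{\<omega> \<in> space M. N \<omega> = A \<and> P A \<omega>} \<in> events" if [measurable]: "finite A" for A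
    by measurable
  have "{\<omega> \<in> space M. finite (N \<omega>) \<and> P (N \<omega>) \<omega>} = (\<Union>A\<in>?F. {\<omega> \<in> space M. N \<omega> = A \<and> P A \<omega>})"
    by auto
  then have "emeasure M {\<omega> \<in> space M. finite (N \<omega>) \<and> P (N \<omega>) \<omega>}
      = (\<integral>\<^sup>+A. emeasure M {\<omega> \<in> space M. N \<omega> = A \<and> P A \<omega>} \<partial>count_space ?F)"
    using ev cnt by (simp, intro emeasure_UN_countable) (auto simp: disjoint_family_on_def)
  also have "\<dots> \<le> (\<integral>\<^sup>+A. \<integral>\<^sup>+\<omega>. ennreal (g (card A)) * indicator {\<omega> \<in> space M. N \<omega> = A} \<omega> \<partial>M \<partial>count_space ?F)"
  proof (intro nn_integral_mono)
    fix A assume "A \<in> space (count_space ?F)"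
    then have A: "finite A" by simp
    have "prob {\<omega> \<in> space M. N \<omega> = A \<and> P A \<omega>} \<le> g (card A) * prob {\<omega> \<in> space M. N \<omega> = A}"
      unfolding indep[OF A] using bound[OF A] by (subst mult.commute) (intro mult_right_mono; simp)
    then have "ennreal (prob {\<omega> \<in> space M. N \<omega> = A \<and> P A \<omega>})
        \<le> ennreal (g (card A)) * ennreal (prob {\<omega> \<in> space M. N \<omega> = A})"
      using order_trans[OF measure_nonneg bound[OF A]] by (simp add: ennreal_mult[symmetric] ennreal_leI)
    then show "emeasure M {\<omega> \<in> space M. N \<omega> = A \<and> P A \<omega>}
        \<le> (\<integral>\<^sup>+\<omega>. ennreal (g (card A)) * indicator {\<omega> \<in> space M. N \<omega> = A} \<omega> \<partial>M)"
      by (simp add: nn_integral_cmult_indicator emeasure_eq_measure)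
  qed
  also have "\<dots> = (\<integral>\<^sup>+\<omega>. \<integral>\<^sup>+A. ennreal (g (card A)) * indicator {\<omega> \<in> space M. N \<omega> = A} \<omega> \<partial>count_space ?F \<partial>M)"
    by (intro nn_integral_count_space_nn_integral[symmetric] cnt) measurable
  also have "\<dots> \<le> (\<integral>\<^sup>+\<omega>. ennreal (g (card (N \<omega>))) \<partial>M)"
  proof (intro nn_integral_mono)
    fix \<omega>
    have "(\<integral>\<^sup>+A. ennreal (g (card A)) * indicator {\<omega> \<in> space M. N \<omega> = A} \<omega> \<partial>count_space ?F)
        \<le> (\<integral>\<^sup>+A. ennreal (g (card (N \<omega>))) * indicator {N \<omega>} A \<partial>count_space ?F)"
      by (intro nn_integral_mono) (auto simp: indicator_def)
    also have "\<dots> \<le> (\<integral>\<^sup>+A. ennreal (g (card (N \<omega>))) * indicator {N \<omega>} A \<partial>count_space UNIV)"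
      by (subst nn_integral_count_space_indicator) (auto intro!: nn_integral_mono simp: indicator_def)
    also have "\<dots> = ennreal (g (card (N \<omega>)))"
      by (subst nn_integral_cmult_indicator) auto
    finally show "(\<integral>\<^sup>+A. ennreal (g (card A)) * indicator {\<omega> \<in> space M. N \<omega> = A} \<omega> \<partial>count_space ?F)
        \<le> ennreal (g (card (N \<omega>)))" .
  qed
  finally show ?thesis .
qed

end

section \<open>The reservation system\<close>

context reservation_system
begin

lemma measurable_sequences [measurable]:
  "\<tau> i \<in> borel_measurable M" "B i \<in> borel_measurable M"
  "\<theta> i \<in> borel_measurable M" "D i \<in> borel_measurable M"
proof -
  have "(\<lambda>\<omega> n. ([\<tau>, B, \<theta>, D] ! k) n \<omega>) \<in> M \<rightarrow>\<^sub>M Pi\<^sub>M UNIV (\<lambda>_. borel)" if "k < 4" for k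
    using indep_sequences that unfolding indep_vars_def by simp
  then have *: "(\<lambda>\<omega>. ([\<tau>, B, \<theta>, D] ! k) i \<omega>) \<in> borel_measurable M" if "k < 4" for k
    using measurable_compose[OF _ measurable_component_singleton[of i UNIV "\<lambda>_. borel"]] that by fastforce
  show "\<tau> i \<in> borel_measurable M" "B i \<in> borel_measurable M"
    "\<theta> i \<in> borel_measurable M" "D i \<in> borel_measurable M"
    using *[of 0] *[of 1] *[of 2] *[of 3] by (simp_all add: numeral_3_eq_3 numeral_2_eq_2)
qed

text \<open>The requests are recorded by their lag behind \<open>n\<close>: lag \<open>k\<close> stands for request \<open>n - 1 - k\<close>. Natural
numbers are used as lags so that counting arguments run over initial segments \<open>{..<m}\<close>. A request
active at any instant of the active period of \<open>n\<close> ends after \<open>\<tau> n\<close>, wherever that period lies, so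
no trace of \<open>D n\<close> and \<open>\<theta> n\<close> is left.\<close>

definition pending :: "int \<Rightarrow> 'a \<Rightarrow> nat set" where
  "pending n \<omega> = {k. \<tau> n \<omega> <
     \<tau> (n - 1 - int k) \<omega> + D (n - 1 - int k) \<omega> + \<theta> (n - 1 - int k) \<omega>}"

lemma sum_interarrival: "(\<Sum>j\<le>k. interarrival \<tau> (n - int j) \<omega>) = \<tau> n \<omega> - \<tau> (n - 1 - int k) \<omega>"
  by (induction k) (auto simp: interarrival_def algebra_simps)

lemma exp_moment_card_pending:
  "\<exists>c>1::real. (AE \<omega> in M. finite (pending n \<omega>)) \<and> integrable M (\<lambda>\<omega>. c ^ card (pending n \<omega>))"
proof -
  have inj: "inj (\<lambda>j. n - int j)" "inj (\<lambda>k. n - 1 - int k)"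
    by (auto simp: inj_def)
  have "pending n = (\<lambda>\<omega>. {k. (\<Sum>j\<le>k. interarrival \<tau> (n - int j) \<omega>)
      < D (n - 1 - int k) \<omega> + \<theta> (n - 1 - int k) \<omega>})"
    by (auto simp: pending_def sum_interarrival fun_eq_iff)
  moreover have "AE \<omega> in M. 0 \<le> \<theta> (n - 1 - int 0) \<omega>"
    using holding_pos[of "n - 1 - int 0"] by eventually_elim simp
  ultimately show ?thesis
    using exp_moment_count_uncovered[of "\<lambda>j. interarrival \<tau> (n - int j)" "\<lambda>k. D (n - 1 - int k)"
        "\<lambda>k. \<theta> (n - 1 - int k)", OF
        iid_reindex[OF iid_interarrival inj(1)] interarrival_nonneg interarrival_integrable _
        iid_reindex[OF iid_delay inj(2)] delay_nonneg delay_integrable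
        iid_reindex[OF iid_holding inj(2)] _ holding_integrable]
      rate_pos by (simp only: interarrival_mean) simp
qed

definition competitors :: "int \<Rightarrow> nat set \<Rightarrow> int set" where
  "competitors n A = insert n ((\<lambda>k. n - 1 - int k) ` A)"

lemma finite_competitors [simp]: "finite A \<Longrightarrow> finite (competitors n A)"
  by (simp add: competitors_def)

lemma card_competitors: "finite A \<Longrightarrow> card (competitors n A) = Suc (card A)"
proof -
  assume "finite A"
  moreover have "n \<notin> (\<lambda>k. n - 1 - int k) ` A" by auto
  moreover have "inj_on (\<lambda>k. n - 1 - int k) A" by (auto simp: inj_on_def)
  ultimately show ?thesis by (simp add: competitors_def card_image)
qed

text \<open>Requests above \<open>C\<close> are always lost and load nothing.\<close>

definition admissible_load :: "real \<Rightarrow> int set \<Rightarrow> 'a \<Rightarrow> real" where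
  "admissible_load C J \<omega> = (\<Sum>i\<in>J. if B i \<omega> \<le> C then B i \<omega> else 0)"

lemma prob_pending_load:
  assumes A: "finite A"
  shows "prob {\<omega> \<in> space M. pending n \<omega> = A \<and> C < admissible_load C (competitors n A) \<omega>}
    = prob {\<omega> \<in> space M. pending n \<omega> = A} * prob {\<omega> \<in> space M. C < admissible_load C (competitors n A) \<omega>}"
proof -
  let ?seq = "Pi\<^sub>M UNIV (\<lambda>_::int. borel :: real measure)"
  let ?X = "\<lambda>k \<omega> n. ([\<tau>, B, \<theta>, D] ! k) n \<omega>"
  \<comment> \<open>Index 1 is the sequence of requirements; 0, 2, 3 are arrivals, holding times and delays.\<close>
  let ?SB = "Pi\<^sub>M {1::nat} (\<lambda>_. ?seq)"
  let ?SZ = "Pi\<^sub>M {0::nat, 2, 3} (\<lambda>_. ?seq)"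
  let ?b = "\<lambda>\<omega>. restrict (\<lambda>k. ?X k \<omega>) {1}"
  let ?z = "\<lambda>\<omega>. restrict (\<lambda>k. ?X k \<omega>) {0, 2, 3}"
  have indep: "indep_var ?SZ ?z ?SB ?b"
    by (rule indep_var_restrict[OF indep_sequences]) auto
  define XB where "XB = {x \<in> space ?SB. C < (\<Sum>i\<in>competitors n A. if x 1 i \<le> C then x 1 i else 0)}"
  define XZ where "XZ = {z \<in> space ?SZ. \<forall>k. k \<in> A \<longleftrightarrow>
      z 0 n < z 0 (n - 1 - int k) + z 3 (n - 1 - int k) + z 2 (n - 1 - int k)}"
  have comp: "(\<lambda>x. x k i) \<in> borel_measurable (Pi\<^sub>M K (\<lambda>_. ?seq))" if "k \<in> K" for k :: nat and i K
    by (rule measurable_compose[OF measurable_component_singleton[OF that]]) simp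
  have [measurable]: "(\<lambda>x. x 1 i) \<in> borel_measurable ?SB" "(\<lambda>x. x 0 i) \<in> borel_measurable ?SZ"
      "(\<lambda>x. x 2 i) \<in> borel_measurable ?SZ" "(\<lambda>x. x 3 i) \<in> borel_measurable ?SZ" for i
    by (rule comp, simp)+
  have [measurable]: "XB \<in> sets ?SB" "XZ \<in> sets ?SZ"
    unfolding XB_def XZ_def by measurable
  have rv: "?z \<in> M \<rightarrow>\<^sub>M ?SZ" "?b \<in> M \<rightarrow>\<^sub>M ?SB"
    using indep by (auto dest: indep_var_rv1 indep_var_rv2)
  have z: "?z -` XZ \<inter> space M = {\<omega> \<in> space M. pending n \<omega> = A}"
    using measurable_space[OF rv(1)] by (auto simp: XZ_def pending_def numeral_2_eq_2 numeral_3_eq_3)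
  have b: "?b -` XB \<inter> space M = {\<omega> \<in> space M. C < admissible_load C (competitors n A) \<omega>}"
    using measurable_space[OF rv(2)] by (auto simp: XB_def admissible_load_def simp del: One_nat_def cong: if_cong)
  have "prob ((\<lambda>x. (?z x, ?b x)) -` (XZ \<times> XB) \<inter> space M) = prob (?z -` XZ \<inter> space M) * prob (?b -` XB \<inter> space M)"
    by (rule indep_varD[OF indep]) measurable
  moreover have "(\<lambda>x. (?z x, ?b x)) -` (XZ \<times> XB) \<inter> space M = (?z -` XZ \<inter> space M) \<inter> (?b -` XB \<inter> space M)"
    by auto
  moreover have "{\<omega> \<in> space M. pending n \<omega> = A} \<inter> {\<omega> \<in> space M. C < admissible_load C (competitors n A) \<omega>}
      = {\<omega> \<in> space M. pending n \<omega> = A \<and> C < admissible_load C (competitors n A) \<omega>}"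
    by auto
  ultimately show ?thesis
    unfolding z b by simp
qed

lemma lost_if_too_large:
  assumes rule: "loss_rule \<tau> B \<theta> D C lost \<omega>" and pos: "\<And>i. 0 < B i \<omega>" "\<And>i. 0 < \<theta> i \<omega>"
    and large: "C < B i \<omega>"
  shows "lost i \<omega>"
proof -
  have "\<tau> i \<omega> + D i \<omega> + \<theta> i \<omega> / 2 \<in> active_period \<tau> \<theta> D i \<omega>"
    using pos(2)[of i] by (simp add: active_period_def)
  \<comment> \<open>The prior load is nonnegative, so any instant of the nonempty active period will do.\<close>
  moreover have "C - B i \<omega> < prior_load \<tau> B \<theta> D lost i t \<omega>" for t
  proof -
    have "0 \<le> prior_load \<tau> B \<theta> D lost i t \<omega>"
      unfolding prior_load_def using pos(1) by (intro sum_nonneg) (simp add: less_imp_le)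
    then show ?thesis using large by simp
  qed
  ultimately show ?thesis
    using rule unfolding loss_rule_def by blast
qed

text \<open>An accepted request that is active during the active period of \<open>n\<close> ends after \<open>\<tau> n\<close>, so it is
pending, and it has requirement at most \<open>C\<close>. Replacing the accepted requests by all pending ones with
requirement at most \<open>C\<close> removes any reference to the loss indicators.\<close>

lemma overload_if_lost:
  assumes rule: "loss_rule \<tau> B \<theta> D C lost \<omega>" and pos: "\<And>i. 0 < B i \<omega>" "\<And>i. 0 < \<theta> i \<omega>" "\<And>i. 0 \<le> D i \<omega>"
    and fin: "finite (pending n \<omega>)" and lost: "lost n \<omega>" and small: "B n \<omega> \<le> C"
  shows "C < admissible_load C (competitors n (pending n \<omega>)) \<omega>"
proof -
  let ?R = "(\<lambda>k. n - 1 - int k) ` pending n \<omega>"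
  let ?tr = "\<lambda>i. if B i \<omega> \<le> C then B i \<omega> else 0"
  obtain t where t: "t \<in> active_period \<tau> \<theta> D n \<omega>" "C - B n \<omega> < prior_load \<tau> B \<theta> D lost n t \<omega>"
    using rule lost unfolding loss_rule_def by blast
  let ?S = "{i. i < n \<and> \<not> lost i \<omega> \<and> t \<in> active_period \<tau> \<theta> D i \<omega>}"
  have "?S \<subseteq> ?R"
  proof
    fix i assume i: "i \<in> ?S"
    then have k: "i = n - 1 - int (nat (n - 1 - i))" by auto
    have "\<tau> n \<omega> < t"
      using t(1) pos(3)[of n] by (simp add: active_period_def)
    also have "t < \<tau> i \<omega> + D i \<omega> + \<theta> i \<omega>"
      using i by (simp add: active_period_def)
    finally have "\<tau> n \<omega> < \<tau> i \<omega> + D i \<omega> + \<theta> i \<omega>" .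
    then have "nat (n - 1 - i) \<in> pending n \<omega>"
      unfolding pending_def mem_Collect_eq k[symmetric] .
    with k show "i \<in> ?R" by blast
  qed
  have "prior_load \<tau> B \<theta> D lost n t \<omega> = (\<Sum>i\<in>?S. ?tr i)"
    unfolding prior_load_def
  proof (intro sum.cong refl)
    fix i assume "i \<in> ?S"
    then have "\<not> C < B i \<omega>"
      using lost_if_too_large[of C lost \<omega> i, OF rule pos(1,2)] by auto
    then show "B i \<omega> = ?tr i" by simp
  qed
  also have "\<dots> \<le> (\<Sum>i\<in>?R. ?tr i)"
    using \<open>?S \<subseteq> ?R\<close> fin pos(1) by (intro sum_mono2) (auto intro: less_imp_le)
  finally have "C < ?tr n + (\<Sum>i\<in>?R. ?tr i)"
    using t(2) small by simp
  moreover have "n \<notin> ?R" by auto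
  ultimately show ?thesis
    using fin by (simp add: admissible_load_def competitors_def)
qed

text \<open>The second term of the upper bound is the excess averaged over the number of competitors: request
\<open>n\<close> itself, whence \<open>Suc\<close>, and the pending requests.\<close>

lemma prob_lost_bounds:
  assumes "subexponential_law (distr M borel (B 0))"
    and loss: "AE \<omega> in M. loss_rule \<tau> B \<theta> D C lost \<omega>"
    and lost [measurable]: "lost n \<in> measurable M (count_space UNIV)"
    and int: "integrable M (\<lambda>\<omega>. positive_law.excess (distr M borel (B 0)) (Suc (card (pending n \<omega>))) C)"
    and fin: "AE \<omega> in M. finite (pending n \<omega>)"
  shows "ccdf (distr M borel (B 0)) C \<le> prob {\<omega> \<in> space M. lost n \<omega>}"
    and "prob {\<omega> \<in> space M. lost n \<omega>} \<le> ccdf (distr M borel (B 0)) C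
      + (\<integral>\<omega>. positive_law.excess (distr M borel (B 0)) (Suc (card (pending n \<omega>))) C \<partial>M)"
proof -
  interpret L: subexponential_law "distr M borel (B 0)" by fact
  have law: "distr M borel (B i) = distr M borel (B 0)" for i
    using iid_B unfolding iid_def by metis
  have surv: "prob {\<omega> \<in> space M. C < B i \<omega>} = L.surv C" for i
    unfolding ccdf_def law[of i, symmetric]
    by (subst measure_distr) (auto intro!: arg_cong[where f=prob])
  have B_pos: "AE \<omega> in M. 0 < B i \<omega>" for i
  proof -
    have "AE x in distr M borel (B i). 0 < x"
      unfolding law[of i] by (rule L.AE_pos)
    then show ?thesis by (subst (asm) AE_distr_iff) auto
  qed
  have B_nonneg: "AE \<omega> in M. 0 \<le> B i \<omega>" for i
    using B_pos[of i] by eventually_elim simp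
  have all: "AE \<omega> in M. (\<forall>i. 0 < B i \<omega>) \<and> (\<forall>i. 0 < \<theta> i \<omega>) \<and> (\<forall>i. 0 \<le> D i \<omega>)"
    using B_pos holding_pos delay_nonneg by (auto simp: AE_all_countable)
  show "L.surv C \<le> prob {\<omega> \<in> space M. lost n \<omega>}"
    unfolding surv[of n, symmetric]
  proof (rule finite_measure_mono_AE)
    show "AE \<omega> in M. \<omega> \<in> {\<omega> \<in> space M. C < B n \<omega>} \<longrightarrow> \<omega> \<in> {\<omega> \<in> space M. lost n \<omega>}"
      using loss all by eventually_elim (auto intro: lost_if_too_large)
  qed measurable
  define Ov where "Ov = {\<omega> \<in> space M. finite (pending n \<omega>)
      \<and> C < admissible_load C (competitors n (pending n \<omega>)) \<omega>}"
  have pend [measurable]: "{\<omega> \<in> space M. k \<in> pending n \<omega>} \<in> events" for k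
    unfolding pending_def by measurable
  have load [measurable]: "admissible_load C J \<in> borel_measurable M" for J
    unfolding admissible_load_def[abs_def] by measurable
  have "emeasure M Ov \<le> (\<integral>\<^sup>+\<omega>. ennreal (L.excess (Suc (card (pending n \<omega>))) C) \<partial>M)"
    unfolding Ov_def
  proof (rule prob_random_set_le)
    fix A :: "nat set" assume A: "finite A"
    show "prob {\<omega> \<in> space M. pending n \<omega> = A \<and> C < admissible_load C (competitors n A) \<omega>}
      = prob {\<omega> \<in> space M. pending n \<omega> = A} * prob {\<omega> \<in> space M. C < admissible_load C (competitors n A) \<omega>}"
      by (rule prob_pending_load[OF A])
    have "indep_vars (\<lambda>_. borel) B (competitors n A)"
      using iid_B by (auto simp: iid_def intro: indep_vars_subset)
    then show "prob {\<omega> \<in> space M. C < admissible_load C (competitors n A) \<omega>} \<le> L.excess (Suc (card A)) C"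
      unfolding admissible_load_def card_competitors[OF A, symmetric, of n]
      using A B_nonneg by (intro L.prob_truncated_sum_gt prob_space_axioms law) auto
  qed (use pend in measurable)
  also have "\<dots> = ennreal (\<integral>\<omega>. L.excess (Suc (card (pending n \<omega>))) C \<partial>M)"
    by (intro nn_integral_eq_integral int) auto
  finally have Ov_le: "prob Ov \<le> (\<integral>\<omega>. L.excess (Suc (card (pending n \<omega>))) C \<partial>M)"
    by (simp add: emeasure_eq_measure integral_nonneg_AE)
  have Ov_ev: "Ov \<in> events"
  proof -
    have "Ov = (\<Union>A\<in>Collect finite. {\<omega> \<in> space M. (\<forall>k. k \<in> pending n \<omega> \<longleftrightarrow> k \<in> A)
        \<and> C < admissible_load C (competitors n A) \<omega>})"
      by (auto simp: Ov_def set_eq_iff[symmetric] Collect_mem_eq)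
    also have "\<dots> \<in> events"
      by (intro sets.countable_UN'' countable_Collect_finite) measurable
    finally show ?thesis .
  qed
  have "prob {\<omega> \<in> space M. lost n \<omega>} \<le> prob ({\<omega> \<in> space M. C < B n \<omega>} \<union> Ov)"
  proof (rule finite_measure_mono_AE)
    show "AE \<omega> in M. \<omega> \<in> {\<omega> \<in> space M. lost n \<omega>} \<longrightarrow> \<omega> \<in> {\<omega> \<in> space M. C < B n \<omega>} \<union> Ov"
      using loss all fin
    proof eventually_elim
      case (elim \<omega>)
      then show ?case
        using overload_if_lost[of C lost \<omega> n]
        by (cases "C < B n \<omega>") (auto simp: Ov_def not_less)
    qed
  qed (use Ov_ev in measurable)
  also have "\<dots> \<le> prob {\<omega> \<in> space M. C < B n \<omega>} + prob Ov"
    using Ov_ev by (intro measure_Un_le) measurable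
  finally show "prob {\<omega> \<in> space M. lost n \<omega>} \<le> L.surv C + (\<integral>\<omega>. L.excess (Suc (card (pending n \<omega>))) C \<partial>M)"
    using Ov_le surv[of n] by simp
qed

text \<open>Dominated convergence: the ratio is at most \<open>K c\<^bsup>k\<^esup>\<close> for \<open>k\<close> competitors, and \<open>c\<close> is chosen such that
this has finite mean over the number of competitors.\<close>

lemma expected_excess_negligible:
  assumes "subexponential_law (distr M borel (B 0))"
  shows "\<And>C. integrable M (\<lambda>\<omega>. positive_law.excess (distr M borel (B 0)) (Suc (card (pending n \<omega>))) C)"
    and "((\<lambda>C. (\<integral>\<omega>. positive_law.excess (distr M borel (B 0)) (Suc (card (pending n \<omega>))) C \<partial>M)
        / ccdf (distr M borel (B 0)) C) \<longlongrightarrow> 0) at_top"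
proof -
  interpret L: subexponential_law "distr M borel (B 0)" by fact
  obtain c :: real where c: "1 < c" "integrable M (\<lambda>\<omega>. c ^ card (pending n \<omega>))"
    using exp_moment_card_pending by blast
  obtain K where K: "\<And>k C. L.excess k C \<le> K * c ^ k * L.surv C"
    using L.excess_le_geometric[OF c(1)] by blast
  have [measurable]: "{\<omega> \<in> space M. k \<in> pending n \<omega>} \<in> events" for k
    unfolding pending_def by measurable
  have [measurable]: "(\<lambda>\<omega>. card (pending n \<omega>)) \<in> measurable M (count_space UNIV)"
    by (rule measurable_card) measurable
  have dom: "integrable M (\<lambda>\<omega>. K * c ^ Suc (card (pending n \<omega>)))"
    using c(2) by simp
  have ratio: "norm (L.excess k C / L.surv C) \<le> K * c ^ k" for k C
    using K[of k C] L.surv_pos[of C] by (simp add: field_simps)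
  have int: "integrable M (\<lambda>\<omega>. L.excess (Suc (card (pending n \<omega>))) C / L.surv C)" for C
    by (rule Bochner_Integration.integrable_bound[OF dom]) (measurable, intro AE_I2 order_trans[OF ratio],
      simp only: real_norm_def abs_ge_self)
  show "integrable M (\<lambda>\<omega>. L.excess (Suc (card (pending n \<omega>))) C)" for C
    using integrable_mult_left[OF int[of C], of "L.surv C"] L.surv_pos[of C] by simp
  have "((\<lambda>C. \<integral>\<omega>. L.excess (Suc (card (pending n \<omega>))) C / L.surv C \<partial>M) \<longlongrightarrow> (\<integral>\<omega>. 0 \<partial>M)) at_top"
  proof (rule integral_dominated_convergence_at_top[OF _ _ dom])
    show "\<forall>\<^sub>F C in at_top. AE \<omega> in M. norm (L.excess (Suc (card (pending n \<omega>))) C / L.surv C)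
        \<le> K * c ^ Suc (card (pending n \<omega>))"
      using ratio by (intro always_eventually allI AE_I2) blast
    show "AE \<omega> in M. ((\<lambda>C. L.excess (Suc (card (pending n \<omega>))) C / L.surv C) \<longlongrightarrow> 0) at_top"
      by (intro AE_I2 L.excess_negligible)
  qed measurable
  then show "((\<lambda>C. (\<integral>\<omega>. L.excess (Suc (card (pending n \<omega>))) C \<partial>M) / L.surv C) \<longlongrightarrow> 0) at_top"
    by simp
qed

end

theorem corollary1:
  fixes M :: "'a measure" and rate :: real
    and \<tau> B \<theta> D :: "int \<Rightarrow> 'a \<Rightarrow> real"
    and lost :: "real \<Rightarrow> int \<Rightarrow> 'a \<Rightarrow> bool"
    and n :: int
  assumes "reservation_system M rate \<tau> B \<theta> D"
    and "subexponential (distr M borel (B 0))"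
    and "\<And>C. 0 < C \<Longrightarrow> stationary_regime M \<tau> B \<theta> D C (lost C)"
  shows "(\<lambda>C. measure M {\<omega> \<in> space M. lost C n \<omega>})
           \<sim>[at_top] (\<lambda>C. measure M {\<omega> \<in> space M. B 0 \<omega> > C})"
proof (rule asymp_equivI')
  interpret reservation_system M rate \<tau> B \<theta> D by fact
  have sub: "subexponential_law (distr M borel (B 0))"
    by (rule subexponential_imp_law) fact
  interpret L: subexponential_law "distr M borel (B 0)" by fact
  let ?E = "\<lambda>C. \<integral>\<omega>. L.excess (Suc (card (pending n \<omega>))) C \<partial>M"
  have surv: "prob {\<omega> \<in> space M. C < B 0 \<omega>} = L.surv C" for C
    unfolding ccdf_def by (subst measure_distr) (auto intro!: arg_cong[where f=prob])
  have fin: "AE \<omega> in M. finite (pending n \<omega>)"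
    using exp_moment_card_pending by blast
  have bounds: "L.surv C \<le> prob {\<omega> \<in> space M. lost C n \<omega>}"
      "prob {\<omega> \<in> space M. lost C n \<omega>} \<le> L.surv C + ?E C" if "0 < C" for C
    using prob_lost_bounds[OF sub _ _ expected_excess_negligible(1)[OF sub] fin, of C "lost C"] assms(3)[OF that]
    by (auto simp: stationary_regime_def)
  show "((\<lambda>C. prob {\<omega> \<in> space M. lost C n \<omega>} / prob {\<omega> \<in> space M. C < B 0 \<omega>}) \<longlongrightarrow> 1) at_top"
    unfolding surv
  proof (rule tendsto_sandwich)
    show "\<forall>\<^sub>F C in at_top. 1 \<le> prob {\<omega> \<in> space M. lost C n \<omega>} / L.surv C"
      using eventually_gt_at_top[of 0]
      by eventually_elim (use bounds(1) L.surv_pos in \<open>simp add: field_simps\<close>)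
    show "\<forall>\<^sub>F C in at_top. prob {\<omega> \<in> space M. lost C n \<omega>} / L.surv C \<le> 1 + ?E C / L.surv C"
      using eventually_gt_at_top[of 0]
    proof eventually_elim
      case (elim C)
      then show ?case
        using bounds(2)[of C] L.surv_pos[of C] by (simp add: field_simps)
    qed
    show "((\<lambda>C. 1 + ?E C / L.surv C) \<longlongrightarrow> 1) at_top"
      using tendsto_add[OF tendsto_const expected_excess_negligible(2)[OF sub, of n], of 1] by simp
  qed simp
qed

end
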